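(* Let $N\ge1$, $q\in(0,\infty)$ and $\gamma\in(0,\infty]$. There exists a constant $K\ge 1$ depending only on $\gamma$, $q$ and $N$ such that for every cube $Q\subset\mathbb{R}^N$, every $u\in BMO(Q)$ and every $k\in[0,\infty)$ with $\|u\|_{BMO(Q)}\le k$, $$K^{-1}\,k\,\mathcal{L}^N\big(\{x\in Q:|u(x)-u_Q|>k\}\big)^{\frac1q}\le \left\|\chi_{\{|u-u_Q|>k\}}(u-u_Q)\right\|_{L^{q,\gamma}(Q)}\le K\,k\,\mathcal{L}^N\big(\{x\in Q:|u(x)-u_Q|>k\}\big)^{\frac1q}.$$
   Context: $\mathcal{L}^N$ is Lebesgue measure; $\chi_E$ is the indicator function of $E$. A cube is a Cartesian product of $N$ non-empty closed bounded intervals of the same (positive) length. $u_Q:=\frac{1}{\mathcal{L}^N(Q)}\int_Q u$. For real-valued $u\in L^1(Q)$, $u\in BMO(Q)$ means that $$\|u\|_{BMO(Q)}:=\sup\left\{\frac{1}{\mathcal{L}^N(C)^2}\int_C\int_C|u(z)-u(x)|\,dz\,dx : C\subset Q\text{ a cube}\right\}<\infty .$$ Lorentz quasi-norms (with Lebesgue measure on $X$): for $0<q<\infty$, $$\|f\|_{L^{q,\gamma}(X)}:=\left[\int_0^\infty\big(\mathcal{L}^N(\{x\in X:|f(x)|^q>t\})\big)^{\frac{\gamma}{q}}t^{\frac{\gamma}{q}-1}dt\right]^{1/\gamma}\ (0<\gamma<\infty),$$ $$\|f\|_{L^{q,\infty}(X)}:=\left[\sup_{0<t<\infty}t\,\mathcal{L}^N(\{x\in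 X:|f(x)|^q>t\})\right]^{1/q}.$$ *)

theory Defs
  imports "HOL-Analysis.Analysis"
begin

definition cube :: "(real ^ 'n) set \<Rightarrow> bool" where
  "cube Q \<longleftrightarrow> (\<exists>a l. l > 0 \<and> Q = {x. \<forall>i. x $ i \<in> {a $ i .. a $ i + l}})"

definition avg :: "(real ^ 'n) set \<Rightarrow> (real ^ 'n \<Rightarrow> real) \<Rightarrow> real" where
  "avg Q u = (1 / measure lebesgue Q) * (LINT x:Q|lebesgue. u x)"

definition bmo_norm :: "(real ^ 'n) set \<Rightarrow> (real ^ 'n \<Rightarrow> real) \<Rightarrow> ennreal" where
  "bmo_norm Q u = (SUP C \<in> {C. cube C \<and> C \<subseteq> Q}.
     (\<integral>\<^sup>+x\<in>C. (\<integral>\<^sup>+z\<in>C. ennreal \<bar>u z - u x\<bar> \<partial>lebesgue) \<partial>lebesgue) / (emeasure lebesgue C)\<^sup>2)"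

definition BMO :: "(real ^ 'n) set \<Rightarrow> (real ^ 'n \<Rightarrow> real) set" where
  "BMO Q = {u. set_integrable lebesgue Q u \<and> bmo_norm Q u < \<infinity>}"

text \<open>Real powers of extended nonnegative reals, meant for exponents \<open>p > 0\<close> only.\<close>

definition epowr :: "ennreal \<Rightarrow> real \<Rightarrow> ennreal" where
  "epowr x p = (if x = \<infinity> then \<infinity> else ennreal (enn2real x powr p))"

definition lorentz_norm ::
  "real \<Rightarrow> ennreal \<Rightarrow> (real ^ 'n) set \<Rightarrow> (real ^ 'n \<Rightarrow> real) \<Rightarrow> ennreal" where
  "lorentz_norm q \<gamma> X f =
     (if \<gamma> = \<infinity>
      then epowr (SUP t \<in> {0<..}. ennreal t * emeasure lebesgue {x \<in> X. \<bar>f x\<bar> powr q > t}) (1 / q)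
      else let g = enn2real \<gamma> in
        epowr (\<integral>\<^sup>+t\<in>{0<..}. epowr (emeasure lebesgue {x \<in> X. \<bar>f x\<bar> powr q > t}) (g / q)
                 * ennreal (t powr (g / q - 1)) \<partial>lborel) (1 / g))"

end

theory Submission
  imports Defs
begin

text \<open>
  The lower bound holds because \<open>|u - u\<^sub>Q| > k\<close> on the set \<open>A = {|u - u\<^sub>Q| > k}\<close>. The upper bound
  reduces to the decay of \<open>|{|u - u\<^sub>Q| > s}|\<close> in \<open>s / k\<close> relative to \<open>|A|\<close>; the rate \<open>(k / s)\<^bsup>2q\<^esup>\<close>
  makes the Lorentz integrals converge.

  A Calderon-Zygmund decomposition of \<open>A\<close> (stopping at density \<open>\<theta> = 2\<^bsup>-(N+2)\<^esup>\<close>) yields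
  non-overlapping cubes of total measure at most \<open>|A| / \<theta>\<close> that cover \<open>A\<close>. The complement of \<open>A\<close>
  fills most of each of them, hence their means stay within \<open>3k\<close> of \<open>u\<^sub>Q\<close>, and the John-Nirenberg inequality on
  each cube bounds the higher level sets. John-Nirenberg itself is the iteration of the same step,
  starting from Chebyshev's inequality. Decomposing sets instead of functions requires only the dyadic
  density theorem in place of Lebesgue's differentiation theorem.
\<close>

subsection \<open>Dyadic stopping cubes\<close>

text \<open>Countable additivity sums the bounds on the pieces. It carries measure comparisons from
  single dyadic cubes to whole sets, in the density theorem and in the level set step alike.\<close>

lemma emeasure_le_by_disjoint_cover:
  assumes F: "countable F" "disjoint F" "F \<subseteq> sets M"
    and X: "X \<in> sets M" and B: "B \<in> sets M"
    and le: "\<And>D. D \<in> F \<Longrightarrow> emeasure M (X \<inter> D) \<le> c * emeasure M (B \<inter> D)"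
    and null: "X - \<Union>F \<in> null_sets M"
  shows "emeasure M X \<le> c * emeasure M B"
proof -
  have dis: "disjoint_family_on (\<lambda>D. Y \<inter> D) F" for Y
    using F(2) by (auto simp: disjoint_family_on_def disjoint_def)
  have U: "\<Union>F \<in> sets M"
    using F by (auto intro: sets.countable_Union)
  have "emeasure M X \<le> emeasure M (X \<inter> \<Union>F) + emeasure M (X - \<Union>F)"
    using emeasure_subadditive[of "X \<inter> \<Union>F" M "X - \<Union>F"] X U by (simp add: Int_Diff_Un)
  also have "\<dots> = emeasure M (\<Union>D\<in>F. X \<inter> D)"
    by (simp only: null_setsD1[OF null] Int_Union add_0_right)
  also have "\<dots> = (\<integral>\<^sup>+D. emeasure M (X \<inter> D) \<partial>count_space F)"
    using F X by (intro emeasure_UN_countable dis) auto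
  also have "\<dots> \<le> (\<integral>\<^sup>+D. c * emeasure M (B \<inter> D) \<partial>count_space F)"
    using le by (intro nn_integral_mono) auto
  also have "\<dots> = c * emeasure M (\<Union>D\<in>F. B \<inter> D)"
    using F B by (subst emeasure_UN_countable[OF _ _ dis]) (auto simp: nn_integral_cmult)
  also have "\<dots> \<le> c * emeasure M B"
    using B by (intro mult_left_mono emeasure_mono) auto
  finally show ?thesis .
qed

text \<open>For \<open>l > 0\<close> this is the half-open cell of side \<open>l / 2 ^ n\<close>
  containing \<open>x\<close> in the grid anchored at \<open>a\<close>. Encoded as a class of the
  relation "equal floors", cells are disjoint or equal without any boundary cases.\<close>

definition dyadic :: "real ^ 'n \<Rightarrow> real \<Rightarrow> nat \<Rightarrow> real ^ 'n \<Rightarrow> (real ^ 'n) set" where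
  "dyadic a l n x = {y. \<forall>i. \<lfloor>2 ^ n * (y $ i - a $ i) / l\<rfloor> = \<lfloor>2 ^ n * (x $ i - a $ i) / l\<rfloor>}"

lemma dyadic_refl: "x \<in> dyadic a l n x"
  by (simp add: dyadic_def)

lemma dyadic_eq: "y \<in> dyadic a l n x \<Longrightarrow> dyadic a l n y = dyadic a l n x"
  by (simp add: dyadic_def)

lemma dyadic_Suc_subset: "dyadic a l (Suc n) x \<subseteq> dyadic a l n x"
proof -
  \<comment> \<open>The index of a parent cell is the index of the child divided by 2 and rounded
    down, so equal indices at level \<open>Suc n\<close> force equal indices at level
    \<open>n\<close>.\<close>
  have "\<lfloor>2 ^ n * z / l\<rfloor> = \<lfloor>2 ^ Suc n * z / l\<rfloor> div 2" for z :: real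
    using floor_divide_real_eq_div[of 2 "2 ^ Suc n * z / l"] by simp
  then show ?thesis
    unfolding dyadic_def by auto
qed

lemma dyadic_antimono: "m \<le> n \<Longrightarrow> dyadic a l n x \<subseteq> dyadic a l m x"
  using lift_Suc_antimono_le[of "\<lambda>n. dyadic a l n x" m n] dyadic_Suc_subset by blast

section \<open>Closed cubes and the measure of dyadic cells\<close>

lemma cube_eq_cbox:
  fixes a :: "real ^ 'n"
  shows
  "{x. \<forall>i. x $ i \<in> {a $ i .. a $ i + l}} = cbox a (\<chi> i. a $ i + l)"
  by (auto simp: mem_box_cart)

lemma cubeE:
  assumes "cube Q"
  obtains a l where "l > 0" "Q = cbox a (\<chi> i. a $ i + l)"
  using assms unfolding cube_def cube_eq_cbox by auto

lemma cube_cbox: "l > 0 \<Longrightarrow> cube (cbox a (\<chi> i. a $ i + l))"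
  unfolding cube_def cube_eq_cbox by auto

lemma measure_cbox_cube:
  fixes a :: "real ^ 'n"
  assumes "l > 0"
  shows "measure lebesgue (cbox a (\<chi> i. a $ i + l)) = l ^ CARD('n)"
proof -
  have "cbox a (\<chi> i. a $ i + l) \<noteq> {}"
    using assms by (auto simp: interval_ne_empty_cart)
  then show ?thesis
    by (simp add: content_cbox_cart)
qed

text \<open>Squeezing a cell between an open and a closed box with the same corners gives its
  measure and links it to the closed cubes over which \<open>bmo_norm\<close> ranges.\<close>

lemma dyadic_near_cbox:
  fixes a x :: "real ^ 'n"
  assumes l: "l > 0"
  obtains b where "box b (\<chi> i. b $ i + l / 2 ^ n) \<subseteq> dyadic a l n x"
    "dyadic a l n x \<subseteq> cbox b (\<chi> i. b $ i + l / 2 ^ n)"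
proof
  \<comment> \<open>Lower corner of the cell containing \<open>x\<close>; the floors are its integer
    grid coordinates.\<close>
  define b :: "real ^ 'n" where "b = (\<chi> i. a $ i + l * \<lfloor>2 ^ n * (x $ i - a $ i) / l\<rfloor> / 2 ^ n)"
  have *: "\<lfloor>2 ^ n * (y $ i - a $ i) / l\<rfloor> = \<lfloor>2 ^ n * (x $ i - a $ i) / l\<rfloor> \<longleftrightarrow>
      b $ i \<le> y $ i \<and> y $ i < b $ i + l / 2 ^ n" for y i
    unfolding floor_eq_iff b_def using l by (simp add: field_simps)
  show "box b (\<chi> i. b $ i + l / 2 ^ n) \<subseteq> dyadic a l n x"
    unfolding dyadic_def * by (auto simp: mem_box_cart less_imp_le)
  show "dyadic a l n x \<subseteq> cbox b (\<chi> i. b $ i + l / 2 ^ n)"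
    unfolding dyadic_def * by (auto simp: mem_box_cart less_imp_le)
qed

text \<open>The sets differ only inside the frontier of the box, which is negligible.\<close>

lemma lmeasurable_between_box_cbox:
  assumes "box b c \<subseteq> D" "D \<subseteq> cbox b c"
  shows "D \<in> lmeasurable" "measure lebesgue D = measure lebesgue (cbox b c)"
    "cbox b c - D \<in> null_sets lebesgue"
proof -
  have neg: "negligible (cbox b c - D)"
    by (rule negligible_subset[OF negligible_frontier_interval]) (use assms in auto)
  moreover have "cbox b c - D \<union> (D - cbox b c) = cbox b c - D"
    using assms by auto
  ultimately show "D \<in> lmeasurable" "measure lebesgue D = measure lebesgue (cbox b c)"
    using lmeasurable_negligible_symdiff[of "cbox b c" D] measure_negligible_symdiff[of "cbox b c" D] by auto
  show "cbox b c - D \<in> null_sets lebesgue"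
    using neg by (simp add: negligible_iff_null_sets)
qed

lemma dyadic_lmeasurable: "l > 0 \<Longrightarrow> dyadic a l n x \<in> lmeasurable"
  by (metis dyadic_near_cbox lmeasurable_between_box_cbox(1))

lemma dyadic_sets: "l > 0 \<Longrightarrow> dyadic a l n x \<in> sets lebesgue"
  using dyadic_lmeasurable by blast

lemma measure_dyadic:
  fixes a x :: "real ^ 'n"
  assumes "l > 0"
  shows "measure lebesgue (dyadic a l n x) = (l / 2 ^ n) ^ CARD('n)"
proof -
  obtain b where "box b (\<chi> i. b $ i + l / 2 ^ n) \<subseteq> dyadic a l n x"
    "dyadic a l n x \<subseteq> cbox b (\<chi> i. b $ i + l / 2 ^ n)"
    using dyadic_near_cbox[OF assms] .
  then show ?thesis
    using lmeasurable_between_box_cbox(2)[of b "\<chi> i. b $ i + l / 2 ^ n" "dyadic a l n x"]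
      measure_cbox_cube[of "l / 2 ^ n" b] assms by simp
qed

lemma emeasure_dyadic:
  fixes a x :: "real ^ 'n"
  assumes "l > 0"
  shows "emeasure lebesgue (dyadic a l n x) = ennreal ((l / 2 ^ n) ^ CARD('n))"
  using dyadic_lmeasurable[OF assms] measure_dyadic[OF assms] by (metis emeasure_eq_measure2)

lemma dyadic_subset_open:
  fixes a x :: "real ^ 'n"
  assumes l: "l > 0" and U: "open U" "x \<in> U"
  obtains n where "dyadic a l n x \<subseteq> U"
proof -
  obtain e where e: "e > 0" "ball x e \<subseteq> U"
    using U open_contains_ball by blast
  \<comment> \<open>In the sum norm the cell has diameter at most
    \<open>CARD('n) * (l / 2 ^ n)\<close>; this \<open>n\<close> makes it smaller than
    \<open>e\<close>.\<close>
  obtain n where n: "l * CARD('n) / e < 2 ^ n"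
    using real_arch_pow[of 2] by auto
  have "dyadic a l n x \<subseteq> ball x e"
  proof
    fix y assume y: "y \<in> dyadic a l n x"
    obtain b where b: "dyadic a l n x \<subseteq> cbox b (\<chi> i. b $ i + l / 2 ^ n)"
      using dyadic_near_cbox[OF l] by blast
    have "\<bar>(x - y) $ i\<bar> \<le> l / 2 ^ n" for i
    proof -
      have "b $ i \<le> x $ i" "x $ i \<le> b $ i + l / 2 ^ n" "b $ i \<le> y $ i" "y $ i \<le> b $ i + l / 2 ^ n"
        using b y dyadic_refl[of x a l n] by (auto simp: mem_box_cart subset_iff)
      then show ?thesis
        by (simp add: abs_le_iff)
    qed
    then have "(\<Sum>i\<in>UNIV. \<bar>(x - y) $ i\<bar>) \<le> CARD('n) * (l / 2 ^ n)"
      by (intro sum_bounded_above) auto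
    then have "dist x y \<le> CARD('n) * (l / 2 ^ n)"
      unfolding dist_norm using norm_le_l1_cart[of "x - y"] by linarith
    also have "\<dots> < e"
      using n e(1) by (simp add: field_simps)
    finally show "y \<in> ball x e"
      by simp
  qed
  then show ?thesis
    using e(2) that by blast
qed

section \<open>Maximal dyadic cubes with a given property\<close>

text \<open>Among the nested cells around each point of \<open>S\<close>, the first one satisfying
  \<open>R\<close> is kept, that is, the maximal one. \<open>R\<close> is left abstract because it
  serves both for "contained in an open set" and for "density above a threshold".\<close>

definition stopping_cubes ::
  "real ^ 'n \<Rightarrow> real \<Rightarrow> ((real ^ 'n) set \<Rightarrow> bool) \<Rightarrow> (real ^ 'n) set \<Rightarrow> (real ^ 'n) set set" where
  "stopping_cubes a l R S =
     {dyadic a l n x | n x. x \<in> S \<and> R (dyadic a l n x) \<and> (\<forall>m<n. \<not> R (dyadic a l m x))}"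

text \<open>A cell is determined by its level and an integer vector, so countably many parameters
  suffice although the definition ranges over points \<open>x\<close>.\<close>

lemma countable_stopping_cubes: "countable (stopping_cubes a l R S)"
proof -
  let ?g = "\<lambda>(n, v :: 'a \<Rightarrow> int). {y. \<forall>i. \<lfloor>2 ^ n * (y $ i - a $ i) / l\<rfloor> = v i}"
  have "stopping_cubes a l R S \<subseteq> range ?g"
    unfolding stopping_cubes_def dyadic_def by (auto simp: image_iff)
  then show ?thesis
    by (rule countable_subset) simp
qed

text \<open>Two cells with a common point share their ancestors down to the coarser level. The
  coarser cell satisfies \<open>R\<close> and would have stopped the finer one earlier; hence the
  levels agree and the cells coincide.\<close>

lemma disjoint_stopping_cubes: "disjoint (stopping_cubes a l R S)"
proof (rule disjointI)
  fix C D assume CD: "C \<in> stopping_cubes a l R S" "D \<in> stopping_cubes a l R S" "C \<noteq> D"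
  obtain n x where C: "C = dyadic a l n x" "R C" "\<forall>m<n. \<not> R (dyadic a l m x)"
    using CD(1) unfolding stopping_cubes_def by auto
  obtain m y where D: "D = dyadic a l m y" "R D" "\<forall>n<m. \<not> R (dyadic a l n y)"
    using CD(2) unfolding stopping_cubes_def by auto
  show "C \<inter> D = {}"
  proof (rule ccontr)
    assume "C \<inter> D \<noteq> {}"
    then obtain z where z: "z \<in> C" "z \<in> D"
      by auto
    have zx: "dyadic a l j z = dyadic a l j x" if "j \<le> n" for j
      using z(1) that dyadic_antimono C(1) by (intro dyadic_eq) blast
    have zy: "dyadic a l j z = dyadic a l j y" if "j \<le> m" for j
      using z(2) that dyadic_antimono D(1) by (intro dyadic_eq) blast
    have "n = m"
    proof (rule linorder_cases[of n m])
      assume "n < m"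
      then show ?thesis
        using D(3) C(1,2) zx[of n] zy[of n] by auto
    next
      assume "m < n"
      then show ?thesis
        using C(3) D(1,2) zx[of m] zy[of m] by auto
    qed
    then show False
      using zx zy C D CD(3) by auto
  qed
qed

lemma stopping_cubes_sets: "l > 0 \<Longrightarrow> stopping_cubes a l R S \<subseteq> sets lebesgue"
  unfolding stopping_cubes_def by (auto intro: dyadic_sets)

lemma in_Union_stopping_cubes:
  assumes "x \<in> S" "R (dyadic a l n x)"
  shows "x \<in> \<Union>(stopping_cubes a l R S)"
proof -
  let ?n = "LEAST n. R (dyadic a l n x)"
  have "R (dyadic a l ?n x)"
    using assms(2) by (rule LeastI)
  then have "dyadic a l ?n x \<in> stopping_cubes a l R S"
    using assms(1) not_less_Least[of _ "\<lambda>n. R (dyadic a l n x)"] unfolding stopping_cubes_def by blast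
  then show ?thesis
    using dyadic_refl by blast
qed

text \<open>Covering \<open>B\<close> by the maximal dyadic cubes inside an open \<open>U \<supseteq> B\<close> gives \<open>|B| \<le> \<theta> |U|\<close>,
  and \<open>|U|\<close> may be taken arbitrarily close to \<open>|B|\<close>.\<close>

lemma dyadic_density_null:
  fixes a :: "real ^ 'n"
  assumes l: "l > 0" and B: "B \<in> lmeasurable" and \<theta>: "0 \<le> \<theta>" "\<theta> < 1"
    and dens: "\<And>x n. x \<in> B \<Longrightarrow>
      emeasure lebesgue (B \<inter> dyadic a l n x) \<le> ennreal \<theta> * emeasure lebesgue (dyadic a l n x)"
  shows "B \<in> null_sets lebesgue"
proof -
  have "measure lebesgue B \<le> \<theta> * measure lebesgue B + e" if "e > 0" for e
  proof -
    obtain U where U: "open U" "B \<subseteq> U" "U - B \<in> lmeasurable" "emeasure lebesgue (U - B) < ennreal e"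
      using sets_lebesgue_outer_open[of B e] B \<open>e > 0\<close> by (auto dest: fmeasurableD)
    have Um: "U \<in> lmeasurable"
      using fmeasurable_Diff_D U B by blast
    let ?F = "stopping_cubes a l (\<lambda>D. D \<subseteq> U) B"
    have "emeasure lebesgue B \<le> ennreal \<theta> * emeasure lebesgue U"
    proof (rule emeasure_le_by_disjoint_cover[where F = ?F])
      fix D assume D: "D \<in> ?F"
      then obtain n x where x: "x \<in> B" "D = dyadic a l n x" "D \<subseteq> U"
        unfolding stopping_cubes_def by auto
      moreover have "U \<inter> D = D"
        using x(3) by auto
      ultimately show "emeasure lebesgue (B \<inter> D) \<le> ennreal \<theta> * emeasure lebesgue (U \<inter> D)"
        using dens[of x n] by simp
    next
      have "x \<in> \<Union>?F" if "x \<in> B" for x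
        using dyadic_subset_open[OF l U(1)] U(2) that by (metis in_Union_stopping_cubes subsetD)
      then have "B - \<Union>?F = {}"
        by blast
      then show "B - \<Union>?F \<in> null_sets lebesgue"
        by (metis null_sets.empty_sets)
    qed (use B Um l in \<open>auto simp: countable_stopping_cubes disjoint_stopping_cubes
          dest: fmeasurableD stopping_cubes_sets\<close>)
    then have "ennreal (measure lebesgue B) \<le> ennreal (\<theta> * measure lebesgue U)"
      using B Um \<theta> by (simp add: emeasure_eq_measure2 ennreal_mult)
    then have "measure lebesgue B \<le> \<theta> * measure lebesgue U"
      using \<theta> by (simp add: ennreal_le_iff)
    also have "measure lebesgue U = measure lebesgue B + measure lebesgue (U - B)"
      using U(2) B Um by (simp add: measurable_measure_Diff fmeasurableD)
    also have "measure lebesgue (U - B) \<le> e"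
      using U(3,4) \<open>e > 0\<close> by (simp add: emeasure_eq_measure2 ennreal_less_iff)
    also have "\<theta> * (measure lebesgue B + e) \<le> \<theta> * measure lebesgue B + e"
      using \<theta> \<open>e > 0\<close> by (simp add: distrib_left mult_left_le_one_le)
    finally show ?thesis
      using \<theta> by (simp add: mult_left_mono)
  qed
  \<comment> \<open>Letting \<open>e\<close> tend to 0 leaves \<open>|B| \<le> \<theta> |B|\<close>
    with \<open>|B|\<close> finite, and \<open>\<theta> < 1\<close> forces
    \<open>|B| = 0\<close>.\<close>
  then have "measure lebesgue B \<le> \<theta> * measure lebesgue B"
    by (rule field_le_epsilon)
  then have "(1 - \<theta>) * measure lebesgue B \<le> 0"
    by (simp add: algebra_simps)
  then have "measure lebesgue B = 0"
    using \<theta> by (metis diff_gt_0_iff_gt measure_nonneg mult_le_0_iff order_antisym not_less)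
  then show ?thesis
    using B negligible_iff_measure0 negligible_iff_null_sets by blast
qed

text \<open>Stop at the first dyadic cell in which \<open>E\<close> has density above
  \<open>\<theta>\<close>. Its parent did not stop and is \<open>2 ^ CARD('n)\<close> times as
  large, whence the upper density bound. Apart from the boundary of \<open>Q\<close>, the uncovered
  part of \<open>E\<close> has density at most \<open>\<theta>\<close> in every cell around its
  points, so it is null. Each half-open \<open>D\<close> comes with a closed cube \<open>C\<close>
  of the same measure, since mean oscillation is controlled on closed cubes.\<close>

lemma Calderon_Zygmund_set:
  fixes Q E :: "(real ^ 'n) set"
  assumes Q: "cube Q" and E: "E \<in> sets lebesgue" "E \<subseteq> Q" and \<theta>: "0 < \<theta>" "\<theta> < 1"
    and small: "emeasure lebesgue E \<le> ennreal \<theta> * emeasure lebesgue Q"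
  obtains F where "countable F" "disjoint F" "F \<subseteq> sets lebesgue" "E - \<Union>F \<in> null_sets lebesgue"
    "\<And>D. D \<in> F \<Longrightarrow> \<exists>C. cube C \<and> C \<subseteq> Q \<and> D \<subseteq> C \<and> emeasure lebesgue D = emeasure lebesgue C \<and>
        ennreal \<theta> * emeasure lebesgue C \<le> emeasure lebesgue (E \<inter> D) \<and>
        emeasure lebesgue (E \<inter> D) \<le> ennreal (2 ^ CARD('n) * \<theta>) * emeasure lebesgue C"
proof -
  obtain a l where l: "l > 0" and Q_eq: "Q = cbox a (\<chi> i. a $ i + l)"
    using cubeE[OF Q] .
  define R where "R D \<longleftrightarrow> ennreal \<theta> * emeasure lebesgue D < emeasure lebesgue (E \<inter> D)" for D
  \<comment> \<open>The root cell: it is \<open>Q\<close> without its upper faces, so only a null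
    set is lost.\<close>
  let ?Q0 = "dyadic a l 0 a"
  let ?F = "stopping_cubes a l R ?Q0"
  have Q0: "box a (\<chi> i. a $ i + l) \<subseteq> ?Q0" "?Q0 \<subseteq> Q"
  proof -
    have "\<lfloor>2 ^ 0 * (y $ i - a $ i) / l\<rfloor> = \<lfloor>2 ^ 0 * (a $ i - a $ i) / l\<rfloor> \<longleftrightarrow>
      a $ i \<le> y $ i \<and> y $ i < a $ i + l" for y i
      unfolding floor_eq_iff using l by (simp add: field_simps)
    then show "box a (\<chi> i. a $ i + l) \<subseteq> ?Q0" "?Q0 \<subseteq> Q"
      unfolding dyadic_def Q_eq by (auto simp: mem_box_cart less_imp_le)
  qed
  have Qnull: "Q - ?Q0 \<in> null_sets lebesgue"
    using lmeasurable_between_box_cbox(3) Q0 Q_eq by blast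
  have emQ0: "emeasure lebesgue Q = emeasure lebesgue ?Q0"
    using l Q0 Q_eq lmeasurable_between_box_cbox[of a "\<chi> i. a $ i + l" ?Q0]
    by (simp add: emeasure_eq_measure2)
  \<comment> \<open>The smallness hypothesis keeps the root from stopping, so every stopping cell
    has a parent.\<close>
  have "\<not> R ?Q0"
    unfolding R_def using small emQ0 emeasure_mono[of "E \<inter> ?Q0" E lebesgue] E(1)
    by (metis inf_le1 linorder_not_less order_trans)
  show ?thesis
  proof
    show "countable ?F" "disjoint ?F" "?F \<subseteq> sets lebesgue"
      using l by (auto simp: countable_stopping_cubes disjoint_stopping_cubes dest: stopping_cubes_sets)
    have UF: "\<Union>?F \<in> sets lebesgue"
      using \<open>countable ?F\<close> \<open>?F \<subseteq> sets lebesgue\<close> by (intro sets.countable_Union)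
    let ?B = "E \<inter> ?Q0 - \<Union>?F"
    have "?B \<in> lmeasurable"
      using fmeasurable_Diff[OF fmeasurable_Int_fmeasurable[OF dyadic_lmeasurable[OF l] E(1)] UF]
      by (simp add: inf_commute)
    then have "?B \<in> null_sets lebesgue"
    proof (rule dyadic_density_null[OF l])
      fix x n assume x: "x \<in> ?B"
      then have "\<not> R (dyadic a l n x)"
        using in_Union_stopping_cubes by blast
      moreover have "emeasure lebesgue (?B \<inter> dyadic a l n x) \<le> emeasure lebesgue (E \<inter> dyadic a l n x)"
        using E(1) dyadic_sets[OF l] by (intro emeasure_mono sets.Int) auto
      ultimately show "emeasure lebesgue (?B \<inter> dyadic a l n x) \<le> ennreal \<theta> * emeasure lebesgue (dyadic a l n x)"
        unfolding R_def by simp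
    qed (use \<theta> in auto)
    then have "?B \<union> (Q - ?Q0) \<in> null_sets lebesgue"
      using Qnull by auto
    then show "E - \<Union>?F \<in> null_sets lebesgue"
      by (rule null_sets_completion_subset[rotated]) (use E(2) in auto)
  next
    fix D assume "D \<in> ?F"
    then obtain n x where x: "x \<in> ?Q0" and D: "D = dyadic a l n x" "R D" "\<forall>m<n. \<not> R (dyadic a l m x)"
      unfolding stopping_cubes_def by auto
    obtain m where n: "n = Suc m"
      using D x \<open>\<not> R ?Q0\<close> dyadic_eq by (metis not0_implies_Suc)
    have DQ0: "D \<subseteq> ?Q0"
      using dyadic_antimono[of 0 n a l x] dyadic_eq[OF x] D(1) by simp
    obtain b where b: "box b (\<chi> i. b $ i + l / 2 ^ n) \<subseteq> D" "D \<subseteq> cbox b (\<chi> i. b $ i + l / 2 ^ n)"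
      using dyadic_near_cbox[OF l] D(1) by blast
    let ?C = "cbox b (\<chi> i. b $ i + l / 2 ^ n)"
    have ln: "l / 2 ^ n > 0"
      using l by simp
    have "?C \<subseteq> Q"
    proof -
      \<comment> \<open>Only the open box is known to lie in \<open>Q\<close>; taking its closure in
        the closed set \<open>Q\<close> recovers the closed cube.\<close>
      have "box b (\<chi> i. b $ i + l / 2 ^ n) \<noteq> {}"
        using ln by (simp add: interval_ne_empty_cart)
      moreover have "closure (box b (\<chi> i. b $ i + l / 2 ^ n)) \<subseteq> Q"
        using b(1) DQ0 Q0(2) Q_eq by (intro closure_minimal) auto
      ultimately show ?thesis
        by simp
    qed
    moreover have emD: "emeasure lebesgue D = emeasure lebesgue ?C"
      using lmeasurable_between_box_cbox[OF b] by (simp add: emeasure_eq_measure2)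
    moreover have "ennreal \<theta> * emeasure lebesgue ?C \<le> emeasure lebesgue (E \<inter> D)"
      using D(2) emD unfolding R_def by simp
    moreover have "emeasure lebesgue (E \<inter> D) \<le> ennreal (2 ^ CARD('n) * \<theta>) * emeasure lebesgue ?C"
    proof -
      have "emeasure lebesgue (E \<inter> D) \<le> emeasure lebesgue (E \<inter> dyadic a l m x)"
        using E(1) dyadic_sets[OF l] D(1) n dyadic_Suc_subset[of a l m x]
        by (intro emeasure_mono sets.Int) auto
      also have "\<dots> \<le> ennreal \<theta> * emeasure lebesgue (dyadic a l m x)"
        using D(3) n unfolding R_def by (simp add: linorder_not_less)
      also have "\<dots> = ennreal (\<theta> * (l / 2 ^ m) ^ CARD('n))"
        using \<theta> l by (simp add: emeasure_dyadic ennreal_mult)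
      also have "(l / 2 ^ m) ^ CARD('n) = 2 ^ CARD('n) * (l / 2 ^ n) ^ CARD('n)"
        unfolding n by (simp add: power_mult_distrib[symmetric])
      also have "ennreal (\<theta> * (2 ^ CARD('n) * (l / 2 ^ n) ^ CARD('n))) =
          ennreal (2 ^ CARD('n) * \<theta>) * emeasure lebesgue D"
        using \<theta> l by (simp add: D(1) emeasure_dyadic ennreal_mult[symmetric] mult_ac)
      finally show ?thesis
        using emD by simp
    qed
    ultimately show "\<exists>C. cube C \<and> C \<subseteq> Q \<and> D \<subseteq> C \<and> emeasure lebesgue D = emeasure lebesgue C \<and>
        ennreal \<theta> * emeasure lebesgue C \<le> emeasure lebesgue (E \<inter> D) \<and>
        emeasure lebesgue (E \<inter> D) \<le> ennreal (2 ^ CARD('n) * \<theta>) * emeasure lebesgue C"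
      using cube_cbox[OF ln, of b] b(2) by blast
  qed
qed

subsection \<open>Exponential decay of level sets\<close>

lemma cube_lmeasurable: "cube Q \<Longrightarrow> Q \<in> lmeasurable"
  by (metis cubeE lmeasurable_cbox)

lemma measure_cube_pos: "cube Q \<Longrightarrow> 0 < measure lebesgue Q"
  by (metis cubeE measure_cbox_cube zero_less_power)

text \<open>Integrability on \<open>Q\<close> yields measurability of
  \<open>indicator Q x * u x\<close>, and on \<open>C \<subseteq> Q\<close> this product agrees with
  \<open>u\<close>.\<close>

lemma superlevel_set_sets:
  fixes u :: "'a::euclidean_space \<Rightarrow> real"
  assumes u: "set_integrable lebesgue Q u" and C: "C \<in> sets lebesgue" "C \<subseteq> Q"
  shows "{x \<in> C. \<bar>u x - c\<bar> > s} \<in> sets lebesgue"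
proof -
  have [measurable]: "(\<lambda>x. indicator Q x * u x) \<in> borel_measurable lebesgue"
    using borel_measurable_integrable u unfolding set_integrable_def by force
  have "{x \<in> space lebesgue. \<bar>indicator Q x * u x - c\<bar> > s} \<in> sets lebesgue"
    by measurable
  then have "C \<inter> {x. \<bar>indicator Q x * u x - c\<bar> > s} \<in> sets lebesgue"
    using C(1) by auto
  also have "C \<inter> {x. \<bar>indicator Q x * u x - c\<bar> > s} = {x \<in> C. \<bar>u x - c\<bar> > s}"
    using C(2) by (auto simp: indicator_def)
  finally show ?thesis .
qed

text \<open>The left side is the absolute value of the integral of \<open>u z - u x\<close> over
  \<open>z\<close> in \<open>C\<close>; the absolute value then moves inside the integral.\<close>

lemma deviation_le_mean_difference:
  fixes u :: "real ^ 'n \<Rightarrow> real"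
  assumes C: "cube C" and u: "set_integrable lebesgue C u"
  shows "ennreal (measure lebesgue C) * ennreal \<bar>u x - avg C u\<bar>
    \<le> (\<integral>\<^sup>+z\<in>C. ennreal \<bar>u z - u x\<bar> \<partial>lebesgue)"
proof -
  let ?m = "measure lebesgue C"
  have Cm: "C \<in> sets lebesgue" "emeasure lebesgue C \<noteq> \<infinity>" and m: "?m > 0"
    using cube_lmeasurable[OF C] measure_cube_pos[OF C] by (auto simp: fmeasurable_def)
  have const: "set_integrable lebesgue C (\<lambda>z. u x)"
    using Cm unfolding set_integrable_def by (auto simp: top.not_eq_extremum)
  have "(LINT z:C|lebesgue. u z - u x) = ?m * (avg C u - u x)"
    using u const Cm m by (simp add: set_integral_const avg_def algebra_simps)
  then have "ennreal ?m * ennreal \<bar>u x - avg C u\<bar> = ennreal (norm (LINT z:C|lebesgue. u z - u x))"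
    using m by (simp add: ennreal_mult[symmetric] abs_mult abs_minus_commute)
  also have "\<dots> \<le> (\<integral>\<^sup>+z. norm (indicat_real C z *\<^sub>R (u z - u x)) \<partial>lebesgue)"
    unfolding set_lebesgue_integral_def
    using set_integral_diff(1)[OF u const] by (intro integral_norm_bound_ennreal) (simp add: set_integrable_def)
  also have "\<dots> = (\<integral>\<^sup>+z\<in>C. ennreal \<bar>u z - u x\<bar> \<partial>lebesgue)"
    by (intro nn_integral_cong) (auto simp: indicator_def)
  finally show ?thesis .
qed

text \<open>Chebyshev's inequality. Integrating the mean difference bound over \<open>x\<close> in
  \<open>C\<close> shows that \<open>|C|\<close> times the integral of \<open>|u - u_C|\<close> is
  at most the double integral in \<open>bmo_norm\<close>, hence at most
  \<open>k |C|^2\<close>.\<close>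

lemma deviation_weak_bound:
  fixes u :: "real ^ 'n \<Rightarrow> real"
  assumes C: "cube C" "C \<subseteq> Q" and u: "set_integrable lebesgue Q u"
    and bmo: "bmo_norm Q u \<le> ennreal k" and k: "0 \<le> k" and s: "0 < s"
  shows "emeasure lebesgue {x \<in> C. \<bar>u x - avg C u\<bar> > s} \<le> ennreal (k / s) * emeasure lebesgue C"
proof -
  let ?m = "measure lebesgue C" and ?S = "{x \<in> C. \<bar>u x - avg C u\<bar> > s}"
  let ?w = "\<lambda>x. ennreal \<bar>u x - avg C u\<bar>"
  have Cm: "C \<in> lmeasurable" and m: "?m > 0"
    using cube_lmeasurable[OF C(1)] measure_cube_pos[OF C(1)] by auto
  have emC: "emeasure lebesgue C = ennreal ?m"
    using Cm by (simp add: emeasure_eq_measure2)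
  have uC: "set_integrable lebesgue C u"
    using set_integrable_subset[OF u] C(2) Cm by blast
  have S: "?S \<in> lmeasurable"
    using superlevel_set_sets[OF uC] Cm by (intro fmeasurableI2[OF Cm]) auto
  have "(\<lambda>x. indicator C x * u x) \<in> borel_measurable lebesgue"
    using borel_measurable_integrable uC unfolding set_integrable_def by force
  then have "(\<lambda>x. ennreal \<bar>indicator C x * u x - avg C u\<bar> * indicator C x) \<in> borel_measurable lebesgue"
    using Cm by measurable
  also have "(\<lambda>x. ennreal \<bar>indicator C x * u x - avg C u\<bar> * indicator C x) = (\<lambda>x. ?w x * indicator C x)"
    by (auto simp: indicator_def)
  finally have w: "(\<lambda>x. ?w x * indicator C x) \<in> borel_measurable lebesgue" .
  let ?J = "\<integral>\<^sup>+x\<in>C. (\<integral>\<^sup>+z\<in>C. ennreal \<bar>u z - u x\<bar> \<partial>lebesgue) \<partial>lebesgue"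
  have "?J / (emeasure lebesgue C)\<^sup>2 \<le> bmo_norm Q u"
    unfolding bmo_norm_def using C by (intro SUP_upper) auto
  also note bmo
  finally have J: "?J \<le> ennreal (k * ?m\<^sup>2)"
  proof -
    assume "?J / (emeasure lebesgue C)\<^sup>2 \<le> ennreal k"
    then have "?J / ennreal (?m\<^sup>2) * ennreal (?m\<^sup>2) \<le> ennreal k * ennreal (?m\<^sup>2)"
      using m by (intro mult_right_mono) (auto simp: emC ennreal_power)
    moreover have "?J / ennreal (?m\<^sup>2) * ennreal (?m\<^sup>2) = ?J"
      using m by (simp add: ennreal_divide_times)
    ultimately show ?thesis
      using k by (simp add: ennreal_mult)
  qed
  have "emeasure lebesgue ?S \<le> emeasure lebesgue {x \<in> C. 1 \<le> ennreal (1 / s) * ?w x}"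
  proof (rule emeasure_mono)
    show "?S \<subseteq> {x \<in> C. 1 \<le> ennreal (1 / s) * ?w x}"
      using s by (auto simp: ennreal_mult[symmetric] simp flip: ennreal_1)
    have "{x \<in> space lebesgue. 1 \<le> ennreal (1 / s) * (?w x * indicator C x)} \<in> sets lebesgue"
      using w by measurable
    also have "{x \<in> space lebesgue. 1 \<le> ennreal (1 / s) * (?w x * indicator C x)} =
        {x \<in> C. 1 \<le> ennreal (1 / s) * ?w x}"
      by (auto simp: indicator_def split: if_splits)
    finally show "{x \<in> C. 1 \<le> ennreal (1 / s) * ?w x} \<in> sets lebesgue" .
  qed
  also have "\<dots> \<le> ennreal (1 / s) * (\<integral>\<^sup>+x\<in>C. ?w x \<partial>lebesgue)"
    using Cm by (intro nn_integral_Markov_inequality w) auto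
  \<comment> \<open>The factor \<open>?m\<close> is inserted so that the pointwise mean difference
    bound applies under the integral; it is cancelled at the end.\<close>
  finally have "ennreal ?m * emeasure lebesgue ?S \<le>
      ennreal ?m * (ennreal (1 / s) * (\<integral>\<^sup>+x\<in>C. ?w x \<partial>lebesgue))"
    by (rule mult_left_mono) simp
  also have "\<dots> = ennreal (1 / s) * (ennreal ?m * (\<integral>\<^sup>+x\<in>C. ?w x \<partial>lebesgue))"
    by (rule mult.left_commute)
  also have "ennreal ?m * (\<integral>\<^sup>+x\<in>C. ?w x \<partial>lebesgue) = (\<integral>\<^sup>+x. ennreal ?m * (?w x * indicator C x) \<partial>lebesgue)"
    using w by (simp add: nn_integral_cmult)
  also have "(\<integral>\<^sup>+x. ennreal ?m * (?w x * indicator C x) \<partial>lebesgue) \<le> ?J"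
  proof (rule nn_integral_mono)
    fix x
    show "ennreal ?m * (?w x * indicator C x) \<le> (\<integral>\<^sup>+z\<in>C. ennreal \<bar>u z - u x\<bar> \<partial>lebesgue) * indicator C x"
      using deviation_le_mean_difference[OF C(1) uC, of x] by (auto simp: indicator_def)
  qed
  also note J
  also have "ennreal ?m * emeasure lebesgue ?S = ennreal (?m * measure lebesgue ?S)"
    using S by (simp add: emeasure_eq_measure2 ennreal_mult)
  also have "ennreal (1 / s) * ennreal (k * ?m\<^sup>2) = ennreal (?m * (k / s * ?m))"
    using s k by (simp add: ennreal_mult[symmetric] power2_eq_square mult_ac)
  finally have "ennreal (?m * measure lebesgue ?S) \<le> ennreal (?m * (k / s * ?m))"
    by (simp add: mult_left_mono)
  then have "?m * measure lebesgue ?S \<le> ?m * (k / s * ?m)"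
    using k s by (subst (asm) ennreal_le_iff) auto
  then have "measure lebesgue ?S \<le> k / s * ?m"
    by (rule mult_left_le_imp_le[OF _ m])
  then have "ennreal (measure lebesgue ?S) \<le> ennreal (k / s * ?m)"
    by (rule ennreal_leI)
  then show ?thesis
    by (simp only: emC emeasure_eq_measure2[OF S] ennreal_mult''[OF measure_nonneg])
qed

lemma bmo_norm_mono: "C \<subseteq> Q \<Longrightarrow> bmo_norm C u \<le> bmo_norm Q u"
  unfolding bmo_norm_def by (rule SUP_subset_mono) auto

text \<open>On a stopping cube \<open>C\<close> of \<open>E\<close> the set \<open>E\<close> occupies at most a quarter, and
  \<open>|u - u\<^sub>C| > 2k\<close> at most a half, so some point witnesses \<open>|u\<^sub>C - c| \<le> s\<^sub>0 + 2k\<close>.\<close>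

lemma superlevel_set_step:
  fixes u :: "real ^ 'n \<Rightarrow> real" and Q :: "(real ^ 'n) set"
  defines "\<theta> \<equiv> 1 / 2 ^ (CARD('n) + 2)"
  assumes Q: "cube Q" and u: "set_integrable lebesgue Q u"
    and bmo: "bmo_norm Q u \<le> ennreal k" and k: "0 < k" and s: "0 \<le> s" and \<psi>: "0 \<le> \<psi>"
    and small: "emeasure lebesgue {x \<in> Q. \<bar>u x - c\<bar> > s\<^sub>0} \<le> ennreal \<theta> * emeasure lebesgue Q"
    and decay: "\<And>C. cube C \<Longrightarrow> C \<subseteq> Q \<Longrightarrow>
      emeasure lebesgue {x \<in> C. \<bar>u x - avg C u\<bar> > s} \<le> ennreal \<psi> * emeasure lebesgue C"
  shows "emeasure lebesgue {x \<in> Q. \<bar>u x - c\<bar> > s + (s\<^sub>0 + 2 * k)}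
    \<le> ennreal (\<psi> / \<theta>) * emeasure lebesgue {x \<in> Q. \<bar>u x - c\<bar> > s\<^sub>0}"
proof -
  let ?E = "{x \<in> Q. \<bar>u x - c\<bar> > s\<^sub>0}" and ?X = "{x \<in> Q. \<bar>u x - c\<bar> > s + (s\<^sub>0 + 2 * k)}"
  have Qm: "Q \<in> sets lebesgue"
    using cube_lmeasurable[OF Q] by blast
  have E: "?E \<in> sets lebesgue" and X: "?X \<in> sets lebesgue"
    using superlevel_set_sets[OF u Qm] by auto
  \<comment> \<open>The exponent \<open>CARD('n) + 2\<close> is chosen for the last equation: the
    upper density bound on stopping cubes becomes 1/4.\<close>
  have \<theta>: "0 < \<theta>" "\<theta> < 1" "2 ^ CARD('n) * \<theta> = 1 / 4"
    unfolding \<theta>_def using one_less_power[of "2::real" "CARD('n) + 2"] by (simp_all add: divide_simps)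
  obtain F where F: "countable F" "disjoint F" "F \<subseteq> sets lebesgue" "?E - \<Union>F \<in> null_sets lebesgue"
    and FC: "\<And>D. D \<in> F \<Longrightarrow> \<exists>C. cube C \<and> C \<subseteq> Q \<and> D \<subseteq> C \<and> emeasure lebesgue D = emeasure lebesgue C \<and>
        ennreal \<theta> * emeasure lebesgue C \<le> emeasure lebesgue (?E \<inter> D) \<and>
        emeasure lebesgue (?E \<inter> D) \<le> ennreal (2 ^ CARD('n) * \<theta>) * emeasure lebesgue C"
    by (rule Calderon_Zygmund_set[OF Q E _ \<theta>(1,2) small]) blast+
  show ?thesis
  proof (rule emeasure_le_by_disjoint_cover[OF F(1-3) X E])
    show "?X - \<Union>F \<in> null_sets lebesgue"
      by (rule null_sets_completion_subset[OF _ F(4)]) (use s k in auto)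
  next
    fix D assume D: "D \<in> F"
    then obtain C where C: "cube C" "C \<subseteq> Q" "D \<subseteq> C" "emeasure lebesgue D = emeasure lebesgue C"
      "ennreal \<theta> * emeasure lebesgue C \<le> emeasure lebesgue (?E \<inter> D)"
      "emeasure lebesgue (?E \<inter> D) \<le> ennreal (1 / 4) * emeasure lebesgue C"
      using FC[OF D] unfolding \<theta>(3) by blast
    let ?m = "measure lebesgue C" and ?W = "{x \<in> C. \<bar>u x - avg C u\<bar> > 2 * k}"
    have Dm: "D \<in> sets lebesgue"
      using D F(3) by blast
    have Cm: "C \<in> lmeasurable" and m: "?m > 0"
      using cube_lmeasurable[OF C(1)] measure_cube_pos[OF C(1)] by auto
    have emC: "emeasure lebesgue C = ennreal ?m"
      using Cm by (simp add: emeasure_eq_measure2)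
    have lev: "{x \<in> C. \<bar>u x - avg C u\<bar> > r} \<in> sets lebesgue" for r
      using superlevel_set_sets[OF u _ C(2)] Cm by blast
    \<comment> \<open>\<open>?E\<close> takes at most 1/4 of \<open>D\<close>, and \<open>?W\<close>
      at most 1/2 by the weak bound at height \<open>2 * k\<close>; together they cannot cover
      \<open>D\<close>.\<close>
    have "\<not> D \<subseteq> (?E \<inter> D) \<union> ?W"
    proof
      assume "D \<subseteq> (?E \<inter> D) \<union> ?W"
      then have "emeasure lebesgue D \<le> emeasure lebesgue ((?E \<inter> D) \<union> ?W)"
        using E Dm lev by (intro emeasure_mono) auto
      also have "\<dots> \<le> emeasure lebesgue (?E \<inter> D) + emeasure lebesgue ?W"
        using E Dm lev by (intro emeasure_subadditive) auto
      also have "\<dots> \<le> ennreal (1 / 4) * ennreal ?m + ennreal (k / (2 * k)) * ennreal ?m"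
        using C(6) deviation_weak_bound[OF C(1,2) u bmo, of "2 * k"] k unfolding emC
        by (intro add_mono) auto
      also have "\<dots> = ennreal (1 / 4 * ?m + k / (2 * k) * ?m)"
        using k m by (subst ennreal_plus) (auto simp only: ennreal_mult''[OF measure_nonneg], auto)
      also have "1 / 4 * ?m + k / (2 * k) * ?m = 3 / 4 * ?m"
        using k by (simp add: field_simps)
      finally show False
        using C(4) m by (simp add: emC ennreal_le_iff)
    qed
    then obtain x where x: "x \<in> D" "x \<notin> ?E" "x \<notin> ?W"
      by blast
    then have avgC: "\<bar>avg C u - c\<bar> \<le> s\<^sub>0 + 2 * k"
      using C(2,3) by auto
    \<comment> \<open>The shift \<open>s\<^sub>0 + 2 * k\<close> absorbs the distance from
      \<open>avg C u\<close> to \<open>c\<close>, so on \<open>D\<close> the high level set around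
      \<open>c\<close> lies in the level set at height \<open>s\<close> around
      \<open>avg C u\<close>.\<close>
    have "emeasure lebesgue (?X \<inter> D) \<le> emeasure lebesgue {x \<in> C. \<bar>u x - avg C u\<bar> > s}"
      using avgC C(3) lev by (intro emeasure_mono) auto
    also have "\<dots> \<le> ennreal \<psi> * emeasure lebesgue C"
      using decay[OF C(1,2)] .
    \<comment> \<open>The lower density bound replaces \<open>|C|\<close> by the measure of
      \<open>?E \<inter> D\<close> at the price of a factor \<open>1 / \<theta>\<close>.\<close>
    also have "\<dots> = ennreal (\<psi> / \<theta>) * (ennreal \<theta> * emeasure lebesgue C)"
      using \<theta> \<psi> by (simp add: mult.assoc[symmetric] ennreal_mult[symmetric])
    also have "\<dots> \<le> ennreal (\<psi> / \<theta>) * emeasure lebesgue (?E \<inter> D)"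
      using C(5) by (intro mult_left_mono) auto
    finally show "emeasure lebesgue (?X \<inter> D) \<le> ennreal (\<psi> / \<theta>) * emeasure lebesgue (?E \<inter> D)" .
  qed
qed

text \<open>The induction runs over all subcubes at once, because the step applies the hypothesis on
  stopping cubes. Each round raises the level by \<open>2 * k / \<theta>\<close>, where the weak
  bound is strong enough, plus \<open>2 * k\<close> for the change of mean, and halves the
  measure.\<close>

lemma John_Nirenberg:
  fixes u :: "real ^ 'n \<Rightarrow> real" and Q :: "(real ^ 'n) set"
  defines "\<theta> \<equiv> 1 / 2 ^ (CARD('n) + 2)"
  assumes u: "set_integrable lebesgue Q u" and bmo: "bmo_norm Q u \<le> ennreal k" and k: "0 < k"
    and C: "cube C" "C \<subseteq> Q"
  shows "emeasure lebesgue {x \<in> C. \<bar>u x - avg C u\<bar> > real j * (2 * k / \<theta> + 2 * k)}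
    \<le> ennreal ((1 / 2) ^ j) * emeasure lebesgue C"
  using C
proof (induction j arbitrary: C)
  case 0
  then show ?case
    using fmeasurableD[OF cube_lmeasurable[OF 0(1)]] emeasure_mono[of "{x \<in> C. u x \<noteq> avg C u}" C lebesgue]
    by simp
next
  case (Suc j)
  let ?T = "2 * k / \<theta> + 2 * k" and ?E = "{x \<in> C. \<bar>u x - avg C u\<bar> > 2 * k / \<theta>}"
  have \<theta>: "0 < \<theta>"
    by (simp add: \<theta>_def)
  have Cm: "C \<in> sets lebesgue"
    using cube_lmeasurable[OF Suc.prems(1)] by blast
  \<comment> \<open>The height \<open>2 * k / \<theta>\<close> is twice what smallness requires; the
    spare factor 1/2 is the gain of each round.\<close>
  have E: "emeasure lebesgue ?E \<le> ennreal (\<theta> / 2) * emeasure lebesgue C"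
    using deviation_weak_bound[OF Suc.prems u bmo, of "2 * k / \<theta>"] k \<theta> by simp
  have "emeasure lebesgue {x \<in> C. \<bar>u x - avg C u\<bar> > real j * ?T + ?T}
      \<le> ennreal ((1 / 2) ^ j / \<theta>) * emeasure lebesgue ?E"
    unfolding \<theta>_def
  proof (rule superlevel_set_step)
    show "bmo_norm C u \<le> ennreal k"
      using bmo_norm_mono[OF Suc.prems(2)] bmo by (rule order_trans)
    show "set_integrable lebesgue C u"
      using set_integrable_subset[OF u Cm Suc.prems(2)] .
    have "ennreal (\<theta> / 2) * emeasure lebesgue C \<le> ennreal \<theta> * emeasure lebesgue C"
      using \<theta> by (intro mult_right_mono ennreal_leI) auto
    then show "emeasure lebesgue {x \<in> C. \<bar>u x - avg C u\<bar> > 2 * k / (1 / 2 ^ (CARD('n) + 2))}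
        \<le> ennreal (1 / 2 ^ (CARD('n) + 2)) * emeasure lebesgue C"
      using E unfolding \<theta>_def by (rule order_trans[rotated])
    show "emeasure lebesgue {x \<in> C'. \<bar>u x - avg C' u\<bar> >
          real j * (2 * k / (1 / 2 ^ (CARD('n) + 2)) + 2 * k)}
        \<le> ennreal ((1 / 2) ^ j) * emeasure lebesgue C'" if "cube C'" "C' \<subseteq> C" for C'
      using Suc.IH[of C'] that Suc.prems unfolding \<theta>_def by blast
  qed (use k Suc.prems in auto)
  \<comment> \<open>The loss \<open>1 / \<theta>\<close> from the stopping cubes meets the gain
    \<open>\<theta> / 2\<close>: a net factor 1/2.\<close>
  also have "\<dots> \<le> ennreal ((1 / 2) ^ j / \<theta>) * (ennreal (\<theta> / 2) * emeasure lebesgue C)"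
    using E by (intro mult_left_mono) auto
  also have "\<dots> = ennreal ((1 / 2) ^ Suc j) * emeasure lebesgue C"
    using \<theta> by (simp add: mult.assoc[symmetric] ennreal_mult[symmetric])
  finally have "emeasure lebesgue {x \<in> C. \<bar>u x - avg C u\<bar> > real j * ?T + ?T}
      \<le> ennreal ((1 / 2) ^ Suc j) * emeasure lebesgue C" .
  moreover have "real j * ?T + ?T = real (Suc j) * ?T"
    by (simp only: of_nat_Suc distrib_right mult_1 add.commute)
  ultimately show ?case
    by (simp only:)
qed

text \<open>If \<open>|u - u\<^sub>Q| > k\<close> on a large part of \<open>Q\<close>, this is John--Nirenberg on \<open>Q\<close> itself;
  otherwise it is John--Nirenberg on the stopping cubes of that set.\<close>

lemma John_Nirenberg_relative:
  fixes u :: "real ^ 'n \<Rightarrow> real" and Q :: "(real ^ 'n) set"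
  defines "\<theta> \<equiv> 1 / 2 ^ (CARD('n) + 2)"
  assumes Q: "cube Q" and u: "set_integrable lebesgue Q u"
    and bmo: "bmo_norm Q u \<le> ennreal k" and k: "0 < k"
  shows "emeasure lebesgue {x \<in> Q. \<bar>u x - avg Q u\<bar> > real j * (2 * k / \<theta> + 2 * k) + 3 * k}
    \<le> ennreal ((1 / 2) ^ j / \<theta>) * emeasure lebesgue {x \<in> Q. \<bar>u x - avg Q u\<bar> > k}"
proof (cases "emeasure lebesgue {x \<in> Q. \<bar>u x - avg Q u\<bar> > k} \<le> ennreal \<theta> * emeasure lebesgue Q")
  case True
  \<comment> \<open>With base level \<open>k\<close> and centre \<open>avg Q u\<close> the shift of
    the step is \<open>k + 2 * k\<close>, the source of the offset \<open>3 * k\<close>.\<close>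
  have "emeasure lebesgue {x \<in> Q. \<bar>u x - avg Q u\<bar> > real j * (2 * k / \<theta> + 2 * k) + (k + 2 * k)}
      \<le> ennreal ((1 / 2) ^ j / \<theta>) * emeasure lebesgue {x \<in> Q. \<bar>u x - avg Q u\<bar> > k}"
    unfolding \<theta>_def
  proof (rule superlevel_set_step[OF Q u bmo k])
    show "emeasure lebesgue {x \<in> Q. \<bar>u x - avg Q u\<bar> > k} \<le> ennreal (1 / 2 ^ (CARD('n) + 2)) * emeasure lebesgue Q"
      using True by (simp only: \<theta>_def)
    show "emeasure lebesgue {x \<in> C. \<bar>u x - avg C u\<bar> >
          real j * (2 * k / (1 / 2 ^ (CARD('n) + 2)) + 2 * k)}
        \<le> ennreal ((1 / 2) ^ j) * emeasure lebesgue C" if "cube C" "C \<subseteq> Q" for C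
      using that by (rule John_Nirenberg[OF u bmo k])
  qed (use k in auto)
  moreover have "k + 2 * k = 3 * k"
    by simp
  ultimately show ?thesis
    by (simp only:)
next
  case False
  have \<theta>: "0 < \<theta>"
    by (simp add: \<theta>_def)
  let ?T = "2 * k / \<theta> + 2 * k"
  have "emeasure lebesgue {x \<in> Q. \<bar>u x - avg Q u\<bar> > real j * ?T + 3 * k} \<le>
      emeasure lebesgue {x \<in> Q. \<bar>u x - avg Q u\<bar> > real j * ?T}"
    using superlevel_set_sets[OF u _ order_refl] cube_lmeasurable[OF Q] k by (intro emeasure_mono) auto
  also have "\<dots> \<le> ennreal ((1 / 2) ^ j) * emeasure lebesgue Q"
    unfolding \<theta>_def by (rule John_Nirenberg[OF u bmo k Q order_refl])
  also have "\<dots> = ennreal ((1 / 2) ^ j / \<theta>) * (ennreal \<theta> * emeasure lebesgue Q)"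
    using \<theta> by (simp add: mult.assoc[symmetric] ennreal_mult[symmetric])
  also have "\<dots> \<le> ennreal ((1 / 2) ^ j / \<theta>) * emeasure lebesgue {x \<in> Q. \<bar>u x - avg Q u\<bar> > k}"
    using False by (intro mult_left_mono) auto
  finally show ?thesis .
qed

section \<open>From exponential to polynomial decay\<close>

lemma powr_le_exp:
  fixes \<sigma> p c :: real
  assumes "0 < \<sigma>" "0 < p" "0 < c"
  shows "\<sigma> powr p \<le> (p / c) powr p * exp (c * \<sigma>)"
proof -
  \<comment> \<open>The inequality \<open>y \<le> exp y\<close> at
    \<open>y = c * \<sigma> / p\<close>, to be raised to the power \<open>p\<close>.\<close>
  have "c * \<sigma> / p \<le> exp (c * \<sigma> / p)"
    using exp_ge_add_one_self[of "c * \<sigma> / p"] by linarith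
  then have "\<sigma> \<le> p / c * exp (c * \<sigma> / p)"
    using assms by (simp add: field_simps)
  then have "\<sigma> powr p \<le> (p / c * exp (c * \<sigma> / p)) powr p"
    using assms by (intro powr_mono2) auto
  also have "\<dots> = (p / c) powr p * exp (c * \<sigma>)"
    using assms by (subst powr_mult) (auto simp: exp_powr_real)
  finally show ?thesis .
qed

text \<open>Exponential decay in \<open>s / k\<close> beats every power. \<open>D\<close> is fixed
  before \<open>Q\<close>, \<open>u\<close>, \<open>k\<close> and \<open>s\<close>, so it depends
  only on \<open>p\<close> and the dimension.\<close>

lemma superlevel_set_polynomial_decay:
  fixes p :: real
  assumes p: "0 < p"
  obtains D :: real where "1 \<le> D"
    "\<And>(Q :: (real ^ 'n) set) u k s. cube Q \<Longrightarrow> set_integrable lebesgue Q u \<Longrightarrow>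
      bmo_norm Q u \<le> ennreal k \<Longrightarrow> 0 < k \<Longrightarrow> k \<le> s \<Longrightarrow>
      emeasure lebesgue {x \<in> Q. \<bar>u x - avg Q u\<bar> > s}
        \<le> ennreal (D * (k / s) powr p) * emeasure lebesgue {x \<in> Q. \<bar>u x - avg Q u\<bar> > k}"
proof
  define \<theta> :: real where "\<theta> = 1 / 2 ^ (CARD('n) + 2)"
  \<comment> \<open>\<open>L * k\<close> is the John-Nirenberg increment
    \<open>2 * k / \<theta> + 2 * k\<close> plus the offset \<open>3 * k\<close>; for
    \<open>j \<ge> 1\<close>, \<open>j\<close> multiples of it dominate \<open>j\<close> increments
    and one offset.\<close>
  define L where "L = 2 / \<theta> + 5"
  define D where "D = max 1 (2 / \<theta> * (p / (ln 2 / L)) powr p)"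
  have \<theta>: "0 < \<theta>" "\<theta> \<le> 1"
    unfolding \<theta>_def using one_le_power[of "2::real" "CARD('n) + 2"] by (simp_all add: divide_simps)
  have L: "L > 0"
    unfolding L_def using \<theta> by (simp add: add_pos_pos)
  show "1 \<le> D"
    by (simp add: D_def)
  fix Q :: "(real ^ 'n) set" and u :: "real ^ 'n \<Rightarrow> real" and k s :: real
  assume Q: "cube Q" and u: "set_integrable lebesgue Q u"
    and bmo: "bmo_norm Q u \<le> ennreal k" and k: "0 < k" and s: "k \<le> s"
  let ?A = "{x \<in> Q. \<bar>u x - avg Q u\<bar> > k}"
  have sets: "{x \<in> Q. \<bar>u x - avg Q u\<bar> > r} \<in> sets lebesgue" for r
    using superlevel_set_sets[OF u _ order_refl] cube_lmeasurable[OF Q] by blast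
  \<comment> \<open>The largest \<open>j\<close> with \<open>j * (L * k) \<le> s\<close>.\<close>
  define j where "j = nat \<lfloor>s / (L * k)\<rfloor>"
  have j: "real j \<le> s / (L * k)" "s / (L * k) < real j + 1"
    unfolding j_def using s k L by (auto simp: of_nat_nat)
  have "emeasure lebesgue {x \<in> Q. \<bar>u x - avg Q u\<bar> > s} \<le> ennreal ((1 / 2) ^ j / \<theta>) * emeasure lebesgue ?A"
  proof (cases "j = 0")
    \<comment> \<open>Below the first multiple of \<open>L * k\<close>, monotonicity suffices
      because \<open>1 / \<theta> \<ge> 1\<close>.\<close>
    case True
    have "emeasure lebesgue {x \<in> Q. \<bar>u x - avg Q u\<bar> > s} \<le> emeasure lebesgue ?A"
      using sets s by (intro emeasure_mono) auto
    also have "\<dots> \<le> ennreal ((1 / 2) ^ j / \<theta>) * emeasure lebesgue ?A"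
      using mult_right_mono[of 1 "ennreal ((1 / 2) ^ j / \<theta>)" "emeasure lebesgue ?A"] \<theta> True
      by simp
    finally show ?thesis .
  next
    case False
    have "real j * (2 * k / \<theta> + 2 * k) + 3 * k \<le> real j * (2 * k / \<theta> + 2 * k) + real j * (3 * k)"
      using False k by simp
    also have "\<dots> = real j * (L * k)"
      by (simp add: L_def algebra_simps)
    also have "\<dots> \<le> s"
      using j(1) L k by (simp add: field_simps)
    finally have "emeasure lebesgue {x \<in> Q. \<bar>u x - avg Q u\<bar> > s} \<le>
        emeasure lebesgue {x \<in> Q. \<bar>u x - avg Q u\<bar> > real j * (2 * k / \<theta> + 2 * k) + 3 * k}"
      using sets by (intro emeasure_mono) auto
    also have "\<dots> \<le> ennreal ((1 / 2) ^ j / \<theta>) * emeasure lebesgue ?A"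
      unfolding \<theta>_def by (rule John_Nirenberg_relative[OF Q u bmo k])
    finally show ?thesis .
  qed
  also have "\<dots> \<le> ennreal (D * (k / s) powr p) * emeasure lebesgue ?A"
  proof (intro mult_right_mono ennreal_leI)
    \<comment> \<open>The rate \<open>ln 2 / L\<close> makes \<open>?e\<close> equal to
      \<open>2 powr (s / (L * k))\<close>, which exceeds \<open>2 ^ j\<close> by a factor of at most
      2.\<close>
    let ?M = "(p / (ln 2 / L)) powr p" and ?e = "exp (ln 2 / L * (s / k))"
    have "?e = 2 powr (s / (L * k))"
      by (simp add: powr_def mult_ac)
    also have "\<dots> \<le> 2 powr (real j + 1)"
      using j(2) by (intro powr_mono) auto
    also have "\<dots> = 2 * 2 ^ j"
      by (simp add: powr_add powr_realpow)
    finally have e: "?e \<le> 2 * 2 ^ j" .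
    have "(s / k) powr p \<le> ?M * ?e"
      using s k p L by (intro powr_le_exp) auto
    also have "\<dots> \<le> ?M * (2 * 2 ^ j)"
      using e by (intro mult_left_mono) auto
    finally have "(s / k) powr p \<le> ?M * (2 * 2 ^ j)" .
    then have "(1 / 2) ^ j / \<theta> * (s / k) powr p \<le> (1 / 2) ^ j / \<theta> * (?M * (2 * 2 ^ j))"
      using \<theta> by (intro mult_left_mono) auto
    also have "\<dots> = 2 / \<theta> * ?M"
      by (simp add: power_one_over field_simps)
    also have "\<dots> \<le> D"
      by (simp add: D_def)
    finally have "(1 / 2) ^ j / \<theta> * (s / k) powr p \<le> D" .
    then have "(1 / 2) ^ j / \<theta> * ((s / k) powr p * (k / s) powr p) \<le> D * (k / s) powr p"
      by (metis mult.assoc mult_right_mono powr_ge_zero)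
    moreover have "(s / k) powr p * (k / s) powr p = 1"
      using s k by (simp add: powr_mult[symmetric])
    ultimately show "(1 / 2) ^ j / \<theta> \<le> D * (k / s) powr p"
      by simp
  qed auto
  finally show "emeasure lebesgue {x \<in> Q. \<bar>u x - avg Q u\<bar> > s}
        \<le> ennreal (D * (k / s) powr p) * emeasure lebesgue ?A" .
qed

subsection \<open>Lorentz quasi-norms and distribution functions\<close>

lemma epowr_mono: "x \<le> y \<Longrightarrow> 0 \<le> p \<Longrightarrow> epowr x p \<le> epowr y p"
  unfolding epowr_def
  by (auto simp: top.not_eq_extremum top_unique intro!: ennreal_leI powr_mono2 enn2real_mono)

lemma epowr_ennreal: "0 \<le> a \<Longrightarrow> epowr (ennreal a) p = ennreal (a powr p)"
  by (simp add: epowr_def)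

lemma nn_integral_powr_from_0:
  fixes p b :: real
  assumes "0 < p" "0 \<le> b"
  shows "(\<integral>\<^sup>+t\<in>{0<..b}. ennreal (t powr (p - 1)) \<partial>lborel) = ennreal (b powr p / p)"
proof -
  have "((\<lambda>t. t powr (p - 1)) has_integral b powr p / p) {0..b}"
    using has_integral_powr_from_0[of "p - 1" b] assms by simp
  then have "(\<integral>\<^sup>+t. ennreal (indicator {0..b} t * t powr (p - 1)) \<partial>lborel) = ennreal (b powr p / p)"
    by (rule nn_integral_has_integral_lebesgue[rotated]) simp
  \<comment> \<open>The integrands agree even at the added endpoint 0, since
    \<open>0 powr (p - 1) = 0\<close>.\<close>
  moreover have "(\<integral>\<^sup>+t\<in>{0<..b}. ennreal (t powr (p - 1)) \<partial>lborel) =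
      (\<integral>\<^sup>+t. ennreal (indicator {0..b} t * t powr (p - 1)) \<partial>lborel)"
    by (intro nn_integral_cong) (auto simp: indicator_def)
  ultimately show ?thesis
    by simp
qed

lemma nn_integral_powr_to_inf:
  fixes p b :: real
  assumes "0 < p" "0 < b"
  shows "(\<integral>\<^sup>+t\<in>{b..}. ennreal (t powr (- p - 1)) \<partial>lborel) = ennreal (b powr (- p) / p)"
proof -
  have "((\<lambda>t. t powr (- p - 1)) has_integral b powr (- p) / p) {b..}"
    using has_integral_powr_to_inf[of "- p - 1" b] assms by simp
  then have "(\<integral>\<^sup>+t. ennreal (indicator {b..} t * t powr (- p - 1)) \<partial>lborel) = ennreal (b powr (- p) / p)"
    by (rule nn_integral_has_integral_lebesgue[rotated]) simp
  moreover have "(\<integral>\<^sup>+t\<in>{b..}. ennreal (t powr (- p - 1)) \<partial>lborel) =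
      (\<integral>\<^sup>+t. ennreal (indicator {b..} t * t powr (- p - 1)) \<partial>lborel)"
    by (intro nn_integral_cong) (auto simp: indicator_def)
  ultimately show ?thesis
    by simp
qed

text \<open>Up to \<open>t = \<kappa> powr q\<close> the bound \<open>m\<close> controls
  \<open>t * \<mu> t\<close>; beyond it the quadratic decay does. In the application
  \<open>\<kappa>\<close> is \<open>k\<close> and \<open>m\<close> is the measure of the set
  \<open>|u - u_Q| > k\<close>.\<close>

lemma lorentz_norm_infinity_le:
  fixes q D m \<kappa> :: real
  assumes q: "0 < q" and D: "1 \<le> D" and m: "0 \<le> m" and \<kappa>: "0 < \<kappa>"
    and bounded: "\<And>t. 0 < t \<Longrightarrow> emeasure lebesgue {x \<in> X. \<bar>f x\<bar> powr q > t} \<le> ennreal m"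
    and decay: "\<And>t. \<kappa> powr q \<le> t \<Longrightarrow>
      emeasure lebesgue {x \<in> X. \<bar>f x\<bar> powr q > t} \<le> ennreal (D * (\<kappa> powr q / t)\<^sup>2 * m)"
  shows "lorentz_norm q \<infinity> X f \<le> ennreal (D powr (1 / q) * \<kappa>) * epowr (ennreal m) (1 / q)"
proof -
  define \<mu> where "\<mu> t = emeasure lebesgue {x \<in> X. \<bar>f x\<bar> powr q > t}" for t
  let ?b = "\<kappa> powr q"
  have bounded: "\<mu> t \<le> ennreal m" if "0 < t" for t
    using bounded[OF that] by (simp only: \<mu>_def)
  have decay: "\<mu> t \<le> ennreal (D * (?b / t)\<^sup>2 * m)" if "?b \<le> t" for t
    using decay[OF that] by (simp only: \<mu>_def)
  have lorentz: "lorentz_norm q \<infinity> X f = epowr (SUP t\<in>{0<..}. ennreal t * \<mu> t) (1 / q)"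
    by (simp only: lorentz_norm_def \<mu>_def simp_thms if_True)
  have b: "?b > 0"
    using \<kappa> by simp
  have "ennreal t * \<mu> t \<le> ennreal (D * ?b * m)" if t: "0 < t" for t
  proof (cases "t \<le> ?b")
    case True
    have "ennreal t * \<mu> t \<le> ennreal t * ennreal m"
      using bounded[OF t] by (rule mult_left_mono) simp
    also have "\<dots> = ennreal (1 * t * m)"
      using t m by (simp add: ennreal_mult)
    also have "\<dots> \<le> ennreal (D * ?b * m)"
      using True t m D by (intro ennreal_leI mult_mono) auto
    finally show ?thesis .
  next
    case False
    have "ennreal t * \<mu> t \<le> ennreal t * ennreal (D * (?b / t)\<^sup>2 * m)"
      using decay[of t] False by (intro mult_left_mono) auto
    also have "\<dots> = ennreal (D * ?b * (?b / t) * m)"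
      using t m D by (simp add: ennreal_mult[symmetric] power2_eq_square field_simps)
    also have "\<dots> \<le> ennreal (D * ?b * 1 * m)"
      using t m D False by (intro ennreal_leI mult_mono) auto
    finally show ?thesis
      by simp
  qed
  then have "(SUP t\<in>{0<..}. ennreal t * \<mu> t) \<le> ennreal (D * ?b * m)"
    by (intro SUP_least) auto
  then have "lorentz_norm q \<infinity> X f \<le> epowr (ennreal (D * ?b * m)) (1 / q)"
    unfolding lorentz using q by (auto intro: epowr_mono)
  also have "\<dots> = ennreal (D powr (1 / q) * \<kappa> * m powr (1 / q))"
    using D m b q \<kappa> by (simp add: epowr_ennreal powr_mult powr_powr)
  finally show ?thesis
    using m \<kappa> by (simp add: epowr_ennreal ennreal_mult)
qed

text \<open>The integral is split at \<open>\<kappa> powr q\<close>. With \<open>p = g / q\<close>,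
  the integrand is at most a multiple of \<open>t powr (p - 1)\<close> below and of
  \<open>t powr (- p - 1)\<close> above, where the quadratic decay supplies
  \<open>t powr (- 2 * p)\<close>; both pieces converge.\<close>

lemma lorentz_norm_finite_le:
  fixes q g D m \<kappa> :: real
  assumes q: "0 < q" and g: "0 < g" and D: "1 \<le> D" and m: "0 \<le> m" and \<kappa>: "0 < \<kappa>"
    and bounded: "\<And>t. 0 < t \<Longrightarrow> emeasure lebesgue {x \<in> X. \<bar>f x\<bar> powr q > t} \<le> ennreal m"
    and decay: "\<And>t. \<kappa> powr q \<le> t \<Longrightarrow>
      emeasure lebesgue {x \<in> X. \<bar>f x\<bar> powr q > t} \<le> ennreal (D * (\<kappa> powr q / t)\<^sup>2 * m)"
  shows "lorentz_norm q (ennreal g) X f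
    \<le> ennreal (((1 + D powr (g / q)) / (g / q)) powr (1 / g) * \<kappa>) * epowr (ennreal m) (1 / q)"
proof -
  define \<mu> where "\<mu> t = emeasure lebesgue {x \<in> X. \<bar>f x\<bar> powr q > t}" for t
  let ?b = "\<kappa> powr q"
  have bounded: "\<mu> t \<le> ennreal m" if "0 < t" for t
    using bounded[OF that] by (simp only: \<mu>_def)
  have decay: "\<mu> t \<le> ennreal (D * (?b / t)\<^sup>2 * m)" if "?b \<le> t" for t
    using decay[OF that] by (simp only: \<mu>_def)
  have lorentz: "lorentz_norm q (ennreal g) X f = epowr (\<integral>\<^sup>+t\<in>{0<..}. epowr (\<mu> t) (g / q)
      * ennreal (t powr (g / q - 1)) \<partial>lborel) (1 / g)"
    using g by (simp only: lorentz_norm_def \<mu>_def Let_def enn2real_ennreal less_imp_le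
        ennreal_neq_top if_False infinity_ennreal_def)
  define p where "p = g / q"
  have p: "p > 0"
    using q g by (simp add: p_def)
  have b: "?b > 0"
    using \<kappa> by simp
  let ?c = "D * ?b\<^sup>2 * m"
  have c: "?c \<ge> 0"
    using D m by simp
  have "(\<integral>\<^sup>+t\<in>{0<..}. epowr (\<mu> t) p * ennreal (t powr (p - 1)) \<partial>lborel) \<le>
    (\<integral>\<^sup>+t. ennreal (m powr p) * (ennreal (t powr (p - 1)) * indicator {0<..?b} t) +
      ennreal (?c powr p) * (ennreal (t powr (- p - 1)) * indicator {?b..} t) \<partial>lborel)"
  proof (rule nn_integral_mono)
    fix t :: real
    consider "t \<le> 0" | "0 < t" "t \<le> ?b" | "?b < t"
      by linarith
    then show "epowr (\<mu> t) p * ennreal (t powr (p - 1)) * indicator {0<..} t \<le>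
      ennreal (m powr p) * (ennreal (t powr (p - 1)) * indicator {0<..?b} t) +
      ennreal (?c powr p) * (ennreal (t powr (- p - 1)) * indicator {?b..} t)"
    proof cases
      case 2
      then have "epowr (\<mu> t) p \<le> ennreal (m powr p)"
        using epowr_mono[OF bounded, of t p] p m by (simp add: epowr_ennreal)
      then show ?thesis
        using 2 by (auto intro!: add_increasing2 mult_right_mono)
    next
      case 3
      have t: "t > 0"
        using 3 b by linarith
      have "epowr (\<mu> t) p \<le> ennreal ((D * (?b / t)\<^sup>2 * m) powr p)"
        using epowr_mono[OF decay, of t p] 3 p m D by (simp add: epowr_ennreal)
      moreover have "(D * (?b / t)\<^sup>2 * m) powr p = ?c powr p * t powr (- 2 * p)"
      proof -
        have "D * (?b / t)\<^sup>2 * m = ?c * t powr (- 2)"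
          using t by (simp add: powr_minus field_simps power2_eq_square)
        then have "(D * (?b / t)\<^sup>2 * m) powr p = (?c * t powr (- 2)) powr p"
          by (rule arg_cong)
        also have "\<dots> = ?c powr p * (t powr (- 2)) powr p"
          by (rule powr_mult)
        finally show ?thesis
          by (simp only: powr_powr)
      qed
      ultimately have "epowr (\<mu> t) p * ennreal (t powr (p - 1)) \<le>
          ennreal (?c powr p * t powr (- 2 * p)) * ennreal (t powr (p - 1))"
        by (intro mult_right_mono) auto
      also have "\<dots> = ennreal (?c powr p * (t powr (- 2 * p) * t powr (p - 1)))"
        by (simp add: ennreal_mult[symmetric] mult.assoc)
      also have "t powr (- 2 * p) * t powr (p - 1) = t powr (- p - 1)"
        by (simp add: powr_add[symmetric])
      finally show ?thesis
        using 3 t by (simp add: ennreal_mult)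
    qed auto
  qed
  also have "\<dots> = ennreal (m powr p) * ennreal (?b powr p / p) + ennreal (?c powr p) * ennreal (?b powr (- p) / p)"
    using p b by (simp add: nn_integral_add nn_integral_cmult nn_integral_powr_from_0 nn_integral_powr_to_inf)
  also have "\<dots> = ennreal (m powr p * (?b powr p / p) + ?c powr p * (?b powr (- p) / p))"
    using p by (simp add: ennreal_mult del: times_divide_eq_right)
  \<comment> \<open>The factor \<open>?b powr (2 * p)\<close> from the decay and
    \<open>?b powr (- p)\<close> from the tail integral combine to \<open>?b powr p\<close>, so both
    pieces scale as \<open>\<kappa> powr g * m powr p\<close>.\<close>
  also have "m powr p * (?b powr p / p) + ?c powr p * (?b powr (- p) / p) =
      (1 + D powr p) / p * \<kappa> powr g * m powr p"
  proof -
    have "?c powr p * ?b powr (- p) = D powr p * m powr p * (?b powr 2) powr p * ?b powr (- p)"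
      using D m b by (simp add: powr_mult)
    also have "\<dots> = D powr p * m powr p * ?b powr p"
      by (simp add: powr_powr powr_add[symmetric] mult.assoc mult.commute[of p q])
    finally have "?c powr p * ?b powr (- p) = D powr p * m powr p * ?b powr p" .
    moreover have "?b powr p = \<kappa> powr g"
      using q by (simp add: powr_powr p_def)
    ultimately show ?thesis
      using p by (simp add: field_simps)
  qed
  finally have "lorentz_norm q (ennreal g) X f \<le>
      epowr (ennreal ((1 + D powr p) / p * \<kappa> powr g * m powr p)) (1 / g)"
    unfolding lorentz using g by (auto simp: p_def intro: epowr_mono)
  also have "\<dots> = ennreal (((1 + D powr p) / p * \<kappa> powr g * m powr p) powr (1 / g))"
    using p m by (intro epowr_ennreal) (auto intro!: add_nonneg_nonneg)
  also have "((1 + D powr p) / p * \<kappa> powr g * m powr p) powr (1 / g) =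
      ((1 + D powr p) / p) powr (1 / g) * \<kappa> * m powr (1 / q)"
  proof -
    have "(\<kappa> powr g) powr (1 / g) = \<kappa>" "(m powr p) powr (1 / g) = m powr (1 / q)"
      using g \<kappa> by (simp_all add: powr_powr p_def)
    then show ?thesis
      using p by (simp only: powr_mult powr_ge_zero)
  qed
  finally show ?thesis
    using m \<kappa> by (simp add: epowr_ennreal ennreal_mult p_def)
qed

text \<open>The supremum is at least its term at \<open>t = \<kappa> powr q\<close>, where the
  measure is still at least \<open>m\<close>.\<close>

lemma lorentz_norm_infinity_ge:
  fixes q m \<kappa> :: real
  assumes q: "0 < q" and m: "0 \<le> m" and \<kappa>: "0 < \<kappa>"
    and lower: "\<And>t. 0 < t \<Longrightarrow> t \<le> \<kappa> powr q \<Longrightarrow> ennreal m \<le> emeasure lebesgue {x \<in> X. \<bar>f x\<bar> powr q > t}"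
  shows "ennreal \<kappa> * epowr (ennreal m) (1 / q) \<le> lorentz_norm q \<infinity> X f"
proof -
  define \<mu> where "\<mu> t = emeasure lebesgue {x \<in> X. \<bar>f x\<bar> powr q > t}" for t
  let ?b = "\<kappa> powr q"
  have lower: "ennreal m \<le> \<mu> t" if "0 < t" "t \<le> ?b" for t
    using lower[OF that] by (simp only: \<mu>_def)
  have lorentz: "lorentz_norm q \<infinity> X f = epowr (SUP t\<in>{0<..}. ennreal t * \<mu> t) (1 / q)"
    by (simp only: lorentz_norm_def \<mu>_def simp_thms if_True)
  have b: "?b > 0"
    using \<kappa> by simp
  have "ennreal (?b * m) \<le> ennreal ?b * \<mu> ?b"
    using lower[of ?b] b m by (simp add: ennreal_mult mult_left_mono)
  also have "\<dots> \<le> (SUP t\<in>{0<..}. ennreal t * \<mu> t)"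
    using b by (intro SUP_upper) auto
  finally have "epowr (ennreal (?b * m)) (1 / q) \<le> lorentz_norm q \<infinity> X f"
    unfolding lorentz using q by (auto intro: epowr_mono)
  moreover have "epowr (ennreal (?b * m)) (1 / q) = ennreal \<kappa> * epowr (ennreal m) (1 / q)"
  proof -
    have "epowr (ennreal (?b * m)) (1 / q) = ennreal ((?b * m) powr (1 / q))"
      using b m by (intro epowr_ennreal) simp
    also have "(?b * m) powr (1 / q) = \<kappa> * m powr (1 / q)"
      using q \<kappa> by (simp add: powr_mult powr_powr)
    finally show ?thesis
      using m \<kappa> by (simp add: epowr_ennreal ennreal_mult)
  qed
  ultimately show ?thesis
    by simp
qed

text \<open>Restricting the integral to \<open>t \<le> \<kappa> powr q\<close> and replacing the
  distribution function by \<open>m\<close> leaves an explicit integral of a power.\<close>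

lemma lorentz_norm_finite_ge:
  fixes q g m \<kappa> :: real
  assumes q: "0 < q" and g: "0 < g" and m: "0 \<le> m" and \<kappa>: "0 < \<kappa>"
    and lower: "\<And>t. 0 < t \<Longrightarrow> t \<le> \<kappa> powr q \<Longrightarrow> ennreal m \<le> emeasure lebesgue {x \<in> X. \<bar>f x\<bar> powr q > t}"
  shows "ennreal ((q / g) powr (1 / g) * \<kappa>) * epowr (ennreal m) (1 / q) \<le> lorentz_norm q (ennreal g) X f"
proof -
  define \<mu> where "\<mu> t = emeasure lebesgue {x \<in> X. \<bar>f x\<bar> powr q > t}" for t
  let ?b = "\<kappa> powr q"
  have lower: "ennreal m \<le> \<mu> t" if "0 < t" "t \<le> ?b" for t
    using lower[OF that] by (simp only: \<mu>_def)
  have lorentz: "lorentz_norm q (ennreal g) X f = epowr (\<integral>\<^sup>+t\<in>{0<..}. epowr (\<mu> t) (g / q)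
      * ennreal (t powr (g / q - 1)) \<partial>lborel) (1 / g)"
    using g by (simp only: lorentz_norm_def \<mu>_def Let_def enn2real_ennreal less_imp_le
        ennreal_neq_top if_False infinity_ennreal_def)
  define p where "p = g / q"
  have p: "p > 0"
    using q g by (simp add: p_def)
  have "ennreal (m powr p * (?b powr p / p)) =
      (\<integral>\<^sup>+t. ennreal (m powr p) * (ennreal (t powr (p - 1)) * indicator {0<..?b} t) \<partial>lborel)"
    using p by (simp add: nn_integral_cmult nn_integral_powr_from_0 ennreal_mult[symmetric])
  also have "\<dots> \<le> (\<integral>\<^sup>+t\<in>{0<..}. epowr (\<mu> t) p * ennreal (t powr (p - 1)) \<partial>lborel)"
  proof (rule nn_integral_mono)
    fix t :: real
    have "ennreal (m powr p) \<le> epowr (\<mu> t) p" if "0 < t" "t \<le> ?b"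
      using epowr_mono[OF lower[OF that], of p] p m by (simp add: epowr_ennreal)
    then show "ennreal (m powr p) * (ennreal (t powr (p - 1)) * indicator {0<..?b} t) \<le>
        epowr (\<mu> t) p * ennreal (t powr (p - 1)) * indicator {0<..} t"
      by (auto simp: indicator_def intro!: mult_right_mono)
  qed
  also have "m powr p * (?b powr p / p) = q / g * \<kappa> powr g * m powr p"
    using q by (simp add: powr_powr p_def)
  finally have "epowr (ennreal (q / g * \<kappa> powr g * m powr p)) (1 / g) \<le> lorentz_norm q (ennreal g) X f"
    unfolding lorentz using g by (auto simp: p_def intro: epowr_mono)
  moreover have "epowr (ennreal (q / g * \<kappa> powr g * m powr p)) (1 / g) =
      ennreal ((q / g) powr (1 / g) * \<kappa>) * epowr (ennreal m) (1 / q)"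
  proof -
    have "(q / g * \<kappa> powr g * m powr p) powr (1 / g) = (q / g) powr (1 / g) * \<kappa> * m powr (1 / q)"
    proof -
      have "(\<kappa> powr g) powr (1 / g) = \<kappa>" "(m powr p) powr (1 / g) = m powr (1 / q)"
        using g \<kappa> by (simp_all add: powr_powr p_def)
      then show ?thesis
        using q g by (simp only: powr_mult powr_ge_zero)
    qed
    moreover have "0 \<le> q / g * \<kappa> powr g * m powr p"
      using q g by simp
    ultimately show ?thesis
      using m \<kappa> by (simp only: epowr_ennreal) (simp add: ennreal_mult)
  qed
  ultimately show ?thesis
    by simp
qed

text \<open>Serves the degenerate case \<open>k = 0\<close>, in which \<open>u\<close> equals its
  mean almost everywhere on \<open>Q\<close>.\<close>

lemma lorentz_norm_eq_0:
  assumes zero: "\<And>t. 0 < t \<Longrightarrow> emeasure lebesgue {x \<in> X. \<bar>f x\<bar> powr q > t} = 0"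
  shows "lorentz_norm q \<gamma> X f = 0"
proof -
  define \<mu> where "\<mu> t = emeasure lebesgue {x \<in> X. \<bar>f x\<bar> powr q > t}" for t
  have zero: "\<mu> t = 0" if "0 < t" for t
    using zero[OF that] by (simp only: \<mu>_def)
  have "(SUP t\<in>{0<..}. ennreal t * \<mu> t) \<le> 0"
    using zero by (intro SUP_least) simp
  moreover have "(\<integral>\<^sup>+t\<in>{0<..}. epowr (\<mu> t) p * ennreal (t powr (p - 1)) \<partial>lborel) = 0" for p
  proof -
    have "(\<lambda>t. epowr (\<mu> t) p * ennreal (t powr (p - 1)) * indicator {0<..} t) = (\<lambda>t. 0)"
      using zero by (intro ext) (auto simp: indicator_def epowr_def)
    then show ?thesis
      by simp
  qed
  ultimately show ?thesis
    unfolding lorentz_norm_def \<mu>_def[symmetric] by (simp add: epowr_def Let_def)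
qed

subsection \<open>The two-sided estimate\<close>

text \<open>Merges finite and infinite \<open>\<gamma>\<close>. \<open>K\<close> is obtained before
  \<open>X\<close>, \<open>f\<close>, \<open>m\<close> and \<open>\<kappa>\<close>, which keeps the
  final constant uniform in the cube and the function.\<close>

lemma lorentz_norm_upper:
  fixes q D :: real
  assumes q: "0 < q" and \<gamma>: "0 < \<gamma>" and D: "1 \<le> D"
  obtains K :: real where
    "\<And>(X :: (real ^ 'n) set) f m \<kappa>. 0 \<le> m \<Longrightarrow> 0 < \<kappa> \<Longrightarrow>
      (\<And>t. 0 < t \<Longrightarrow> emeasure lebesgue {x \<in> X. \<bar>f x\<bar> powr q > t} \<le> ennreal m) \<Longrightarrow>
      (\<And>t. \<kappa> powr q \<le> t \<Longrightarrow>
        emeasure lebesgue {x \<in> X. \<bar>f x\<bar> powr q > t} \<le> ennreal (D * (\<kappa> powr q / t)\<^sup>2 * m)) \<Longrightarrow>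
      lorentz_norm q \<gamma> X f \<le> ennreal (K * \<kappa>) * epowr (ennreal m) (1 / q)"
proof (cases \<gamma>)
  case (real g)
  then have "0 < g"
    using \<gamma> by (simp add: less_le)
  then show ?thesis
    using that lorentz_norm_finite_le[OF q _ D] real(2) by blast
next
  case top
  then show ?thesis
    using that lorentz_norm_infinity_le[OF q D] unfolding infinity_ennreal_def by blast
qed

lemma lorentz_norm_lower:
  fixes q :: real
  assumes q: "0 < q" and \<gamma>: "0 < \<gamma>"
  obtains c :: real where "0 < c"
    "\<And>(X :: (real ^ 'n) set) f m \<kappa>. 0 \<le> m \<Longrightarrow> 0 < \<kappa> \<Longrightarrow>
      (\<And>t. 0 < t \<Longrightarrow> t \<le> \<kappa> powr q \<Longrightarrow> ennreal m \<le> emeasure lebesgue {x \<in> X. \<bar>f x\<bar> powr q > t}) \<Longrightarrow>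
      ennreal (c * \<kappa>) * epowr (ennreal m) (1 / q) \<le> lorentz_norm q \<gamma> X f"
proof (cases \<gamma>)
  case (real g)
  then have g: "0 < g"
    using \<gamma> by (simp add: less_le)
  have "0 < (q / g) powr (1 / g)"
    using q g by simp
  then show ?thesis
    using that lorentz_norm_finite_ge[OF q g] real(2) by blast
next
  case top
  have "ennreal (1 * \<kappa>) * epowr (ennreal m) (1 / q) \<le> lorentz_norm q \<gamma> X f"
    if "0 \<le> m" "0 < \<kappa>"
      "\<And>t. 0 < t \<Longrightarrow> t \<le> \<kappa> powr q \<Longrightarrow> ennreal m \<le> emeasure lebesgue {x \<in> X. \<bar>f x\<bar> powr q > t}"
    for X :: "(real ^ 'n) set" and f m \<kappa>
    using lorentz_norm_infinity_ge[OF q that] unfolding top infinity_ennreal_def mult_1 .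
  then show ?thesis
    using that[of 1] zero_less_one by blast
qed

text \<open>For \<open>k \<ge> 0\<close> the truncation freezes the distribution function at its
  value for height \<open>k\<close> while \<open>t \<le> k powr q\<close>, and leaves it unchanged
  beyond.\<close>

lemma truncated_superlevel_set:
  fixes w :: "'a \<Rightarrow> real"
  assumes "0 < q" "0 < t"
  shows "{x \<in> Q. \<bar>indicator {x \<in> Q. \<bar>w x\<bar> > k} x * w x\<bar> powr q > t} =
    {x \<in> Q. \<bar>w x\<bar> > k \<and> \<bar>w x\<bar> > t powr (1 / q)}"
proof -
  have "t < \<bar>w x\<bar> powr q \<longleftrightarrow> t powr (1 / q) < \<bar>w x\<bar>" for x
  proof -
    have "t = (t powr (1 / q)) powr q"
      using assms by (simp add: powr_powr)
    then show ?thesis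
      by (metis abs_ge_zero assms(1) linorder_not_less powr_ge_zero powr_less_mono2 powr_mono2 less_imp_le)
  qed
  then show ?thesis
    using assms by (auto simp: indicator_def)
qed

theorem theorem1p4:
  fixes q :: real and \<gamma> :: ennreal
  assumes "0 < q" and "0 < \<gamma>"
  shows "\<exists>K::real. K \<ge> 1 \<and>
    (\<forall>(Q :: (real ^ 'n) set) u k. cube Q \<longrightarrow> u \<in> BMO Q \<longrightarrow> 0 \<le> k \<longrightarrow> bmo_norm Q u \<le> ennreal k \<longrightarrow>
      ennreal (inverse K * k) * epowr (emeasure lebesgue {x \<in> Q. \<bar>u x - avg Q u\<bar> > k}) (1 / q)
        \<le> lorentz_norm q \<gamma> Q (\<lambda>x. indicator {x \<in> Q. \<bar>u x - avg Q u\<bar> > k} x * (u x - avg Q u))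
      \<and> lorentz_norm q \<gamma> Q (\<lambda>x. indicator {x \<in> Q. \<bar>u x - avg Q u\<bar> > k} x * (u x - avg Q u))
        \<le> ennreal (K * k) * epowr (emeasure lebesgue {x \<in> Q. \<bar>u x - avg Q u\<bar> > k}) (1 / q))"
proof -
  have q: "0 < q" "0 < 2 * q"
    using assms(1) by auto
  \<comment> \<open>Order \<open>2 * q\<close> in the height \<open>s\<close> becomes order 2 in
    \<open>t = s powr q\<close>, the decay that the Lorentz bounds ask for.\<close>
  obtain D :: real where D: "1 \<le> D"
    and decay: "\<And>(Q :: (real ^ 'n) set) u k s. cube Q \<Longrightarrow> set_integrable lebesgue Q u \<Longrightarrow>
      bmo_norm Q u \<le> ennreal k \<Longrightarrow> 0 < k \<Longrightarrow> k \<le> s \<Longrightarrow>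
      emeasure lebesgue {x \<in> Q. \<bar>u x - avg Q u\<bar> > s}
        \<le> ennreal (D * (k / s) powr (2 * q)) * emeasure lebesgue {x \<in> Q. \<bar>u x - avg Q u\<bar> > k}"
    using superlevel_set_polynomial_decay[OF q(2)] by blast
  obtain K :: real where upper:
    "\<And>(X :: (real ^ 'n) set) f m \<kappa>. 0 \<le> m \<Longrightarrow> 0 < \<kappa> \<Longrightarrow>
      (\<And>t. 0 < t \<Longrightarrow> emeasure lebesgue {x \<in> X. \<bar>f x\<bar> powr q > t} \<le> ennreal m) \<Longrightarrow>
      (\<And>t. \<kappa> powr q \<le> t \<Longrightarrow>
        emeasure lebesgue {x \<in> X. \<bar>f x\<bar> powr q > t} \<le> ennreal (D * (\<kappa> powr q / t)\<^sup>2 * m)) \<Longrightarrow>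
      lorentz_norm q \<gamma> X f \<le> ennreal (K * \<kappa>) * epowr (ennreal m) (1 / q)"
    using lorentz_norm_upper[OF assms D] by blast
  obtain c :: real where c: "0 < c" and lower:
    "\<And>(X :: (real ^ 'n) set) f m \<kappa>. 0 \<le> m \<Longrightarrow> 0 < \<kappa> \<Longrightarrow>
      (\<And>t. 0 < t \<Longrightarrow> t \<le> \<kappa> powr q \<Longrightarrow> ennreal m \<le> emeasure lebesgue {x \<in> X. \<bar>f x\<bar> powr q > t}) \<Longrightarrow>
      ennreal (c * \<kappa>) * epowr (ennreal m) (1 / q) \<le> lorentz_norm q \<gamma> X f"
    using lorentz_norm_lower[OF assms] by blast
  \<comment> \<open>One constant for both directions: at least 1, at least the upper constant, and
    with inverse at most \<open>c\<close>.\<close>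
  define K' where "K' = max 1 (max K (1 / c))"
  have K': "1 \<le> K'" "K \<le> K'" "inverse K' \<le> c"
  proof -
    have "inverse K' \<le> inverse (1 / c)"
      using c by (intro le_imp_inverse_le) (auto simp: K'_def)
    then show "1 \<le> K'" "K \<le> K'" "inverse K' \<le> c"
      by (auto simp: K'_def)
  qed
  show ?thesis
  proof (intro exI[of _ K'] conjI allI impI)
    show "1 \<le> K'"
      by fact
  next
    fix Q :: "(real ^ 'n) set" and u :: "real ^ 'n \<Rightarrow> real" and k :: real
    assume Q: "cube Q" and u: "u \<in> BMO Q" and k: "0 \<le> k" and bmo: "bmo_norm Q u \<le> ennreal k"
    let ?A = "{x \<in> Q. \<bar>u x - avg Q u\<bar> > k}"
    let ?f = "\<lambda>x. indicator ?A x * (u x - avg Q u)"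
    have int: "set_integrable lebesgue Q u"
      using u by (simp add: BMO_def)
    have Qm: "Q \<in> lmeasurable"
      using cube_lmeasurable[OF Q] .
    have lev: "{x \<in> Q. \<bar>u x - avg Q u\<bar> > r} \<in> sets lebesgue" for r
      using superlevel_set_sets[OF int _ order_refl] Qm by blast
    have "?A \<in> lmeasurable"
      using lev by (intro fmeasurableI2[OF Qm]) auto
    then have mA: "emeasure lebesgue ?A = ennreal (measure lebesgue ?A)"
      by (rule emeasure_eq_measure2)
    have dist: "{x \<in> Q. \<bar>?f x\<bar> powr q > t} = {x \<in> Q. \<bar>u x - avg Q u\<bar> > max k (t powr (1 / q))}" if "0 < t" for t
      unfolding truncated_superlevel_set[OF q(1) that] by auto
    have kq: "(k powr q) powr (1 / q) = k"
      using q k by (simp add: powr_powr)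
    have "ennreal (inverse K' * k) * epowr (emeasure lebesgue ?A) (1 / q) \<le> lorentz_norm q \<gamma> Q ?f \<and>
        lorentz_norm q \<gamma> Q ?f \<le> ennreal (K' * k) * epowr (emeasure lebesgue ?A) (1 / q)"
    proof (cases "k = 0")
      case True
      \<comment> \<open>The weak bound with \<open>k = 0\<close> has factor 0 at every positive
        height, so all these level sets are null and both sides of the estimate vanish.\<close>
      have "emeasure lebesgue {x \<in> Q. \<bar>?f x\<bar> powr q > t} = 0" if "0 < t" for t
      proof -
        have "emeasure lebesgue {x \<in> Q. \<bar>u x - avg Q u\<bar> > max k (t powr (1 / q))}
            \<le> ennreal (k / max k (t powr (1 / q))) * emeasure lebesgue Q"
          by (rule deviation_weak_bound[OF Q order_refl int bmo k]) (use that in \<open>simp add: less_max_iff_disj\<close>)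
        then show ?thesis
          unfolding dist[OF that] by (simp only: True div_0 ennreal_0 mult_zero_left le_zero_eq)
      qed
      then have "lorentz_norm q \<gamma> Q ?f = 0"
        by (rule lorentz_norm_eq_0)
      then show ?thesis
        by (simp only: True mult_zero_right ennreal_0 mult_zero_left order_refl simp_thms)
    next
      case False
      then have k: "0 < k"
        using k by simp
      have "ennreal (c * k) * epowr (emeasure lebesgue ?A) (1 / q) \<le> lorentz_norm q \<gamma> Q ?f"
        unfolding mA
      proof (rule lower)
        fix t assume t: "0 < t" "t \<le> k powr q"
        \<comment> \<open>In this range the truncation decides, and the level set of
          \<open>?f\<close> is \<open>?A\<close> itself.\<close>
        have "t powr (1 / q) \<le> k"
          using powr_mono2[of "1 / q" t "k powr q"] t q kq by simp
        then show "ennreal (measure lebesgue ?A) \<le> emeasure lebesgue {x \<in> Q. \<bar>?f x\<bar> powr q > t}"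
          unfolding dist[OF t(1)] by (simp only: max_absorb1 mA[symmetric] order_refl)
      qed (use k in auto)
      moreover have "ennreal (inverse K' * k) \<le> ennreal (c * k)"
        using K'(3) k by (intro ennreal_leI mult_right_mono) auto
      moreover have "lorentz_norm q \<gamma> Q ?f \<le> ennreal (K * k) * epowr (emeasure lebesgue ?A) (1 / q)"
        unfolding mA
      proof (rule upper)
        fix t :: real assume t: "0 < t"
        show "emeasure lebesgue {x \<in> Q. \<bar>?f x\<bar> powr q > t} \<le> ennreal (measure lebesgue ?A)"
          unfolding dist[OF t] mA[symmetric] using lev by (intro emeasure_mono) auto
      next
        fix t assume t: "k powr q \<le> t"
        have t0: "0 < t"
          using t k powr_gt_zero[of k q] by linarith
        let ?s = "t powr (1 / q)"
        have s: "k \<le> ?s"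
          using powr_mono2[of "1 / q" "k powr q" t] t q kq by simp
        \<comment> \<open>Turns the decay in the height \<open>?s\<close> into quadratic decay in
          \<open>t\<close>.\<close>
        have "(k / ?s) powr (2 * q) = (k powr q / t)\<^sup>2"
        proof -
          have "(k / ?s) powr (2 * q) = ((k / ?s) powr q) powr 2"
            by (simp add: powr_powr mult.commute)
          also have "(k / ?s) powr q = k powr q / t"
            using k t0 q by (simp add: powr_divide powr_powr)
          finally show ?thesis
            using k t0 by simp
        qed
        then have "emeasure lebesgue {x \<in> Q. \<bar>u x - avg Q u\<bar> > ?s}
            \<le> ennreal (D * (k powr q / t)\<^sup>2) * emeasure lebesgue ?A"
          using decay[OF Q int bmo k s] by (simp only:)
        then show "emeasure lebesgue {x \<in> Q. \<bar>?f x\<bar> powr q > t}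
            \<le> ennreal (D * (k powr q / t)\<^sup>2 * measure lebesgue ?A)"
          unfolding dist[OF t0] max_absorb2[OF s] mA ennreal_mult''[OF measure_nonneg] .
      qed (use k in auto)
      moreover have "ennreal (K * k) \<le> ennreal (K' * k)"
        using K'(2) k by (intro ennreal_leI mult_right_mono) auto
      ultimately show ?thesis
        by (meson mult_right_mono order_trans zero_le)
    qed
    then show "ennreal (inverse K' * k) * epowr (emeasure lebesgue ?A) (1 / q) \<le> lorentz_norm q \<gamma> Q ?f"
      "lorentz_norm q \<gamma> Q ?f \<le> ennreal (K' * k) * epowr (emeasure lebesgue ?A) (1 / q)"
      by blast+
  qed
qed

end
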